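(* Let $G=\mathrm{SL}_2(\mathbb Z)$, let $B_X=\{\gamma\in G:\|\gamma\|\le X\}$, and let $\mu_X$ be the normalized counting measure on $B_X^2$. For $g=(g_1,g_2)$ let $\Gamma(g)=\langle g_1,g_1^{-1},g_2,g_2^{-1}\rangle$. Then $$\lim_{X\to\infty}\mu_X\big(\{g=(g_1,g_2)\in G^2 : \Gamma(g)\text{ is thin}\}\big)=1.$$
   Context: For $\gamma\in\mathrm{SL}_2(\mathbb R)$, $\|\gamma\|^2=\lambda_{\max}(\gamma^t\gamma)$ (largest eigenvalue). A subgroup $\Gamma\le \mathrm{GL}_n(\mathbb Z)$ with Zariski closure $\overline{\Gamma}$ in $\mathrm{GL}_n(\mathbb C)$ is thin if it has infinite index in $\overline{\Gamma}\cap\mathrm{GL}_n(\mathbb Z)$. *)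

theory Defs
  imports "HOL-Analysis.Analysis"
begin

type_synonym imat = "int ^ 2 ^ 2"
type_synonym cmat = "complex ^ 2 ^ 2"

definition SL2Z :: "imat set" where
  "SL2Z = {A. det A = 1}"

definition GL2Z :: "imat set" where
  "GL2Z = {A. det A = 1 \<or> det A = -1}"

definition to_real :: "imat \<Rightarrow> real ^ 2 ^ 2" where
  "to_real A = (\<chi> i j. real_of_int (A $ i $ j))"

definition to_cplx :: "imat \<Rightarrow> cmat" where
  "to_cplx A = (\<chi> i j. complex_of_int (A $ i $ j))"

definition lambda_max :: "real ^ 2 ^ 2 \<Rightarrow> real" where
  "lambda_max M = Sup {l. \<exists>v::real^2. v \<noteq> 0 \<and> M *v v = l *\<^sub>R v}"

definition mnorm :: "imat \<Rightarrow> real" where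
  "mnorm g = sqrt (lambda_max (transpose (to_real g) ** to_real g))"

definition ball_X :: "real \<Rightarrow> imat set" where
  "ball_X X = {g \<in> SL2Z. mnorm g \<le> X}"

definition sl2_inv :: "imat \<Rightarrow> imat" where
  "sl2_inv A = (\<chi> i j. if i = 1 \<and> j = 1 then A $ 2 $ 2
                        else if i = 2 \<and> j = 2 then A $ 1 $ 1
                        else - A $ i $ j)"

inductive_set gen_group :: "imat set \<Rightarrow> imat set" for S where
  gen_one: "mat 1 \<in> gen_group S"
| gen_base: "s \<in> S \<Longrightarrow> s \<in> gen_group S"
| gen_mult: "a \<in> gen_group S \<Longrightarrow> b \<in> gen_group S \<Longrightarrow> a ** b \<in> gen_group S"
| gen_inv: "a \<in> gen_group S \<Longrightarrow> sl2_inv a \<in> gen_group S"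

definition Gamma :: "imat \<times> imat \<Rightarrow> imat set" where
  "Gamma g = gen_group {fst g, sl2_inv (fst g), snd g, sl2_inv (snd g)}"

(* polynomials in the four matrix entries, as finitely supported coefficient
   functions on exponent vectors (a,b,c,d) for x11^a x12^b x21^c x22^d *)
definition is_poly4 :: "(nat \<times> nat \<times> nat \<times> nat \<Rightarrow> complex) \<Rightarrow> bool" where
  "is_poly4 p \<longleftrightarrow> finite {e. p e \<noteq> 0}"

definition eval_poly4 :: "(nat \<times> nat \<times> nat \<times> nat \<Rightarrow> complex) \<Rightarrow> cmat \<Rightarrow> complex" where
  "eval_poly4 p M = (\<Sum>e\<in>{e. p e \<noteq> 0}. case e of (a, b, c, d) \<Rightarrow>
      p e * (M $ 1 $ 1) ^ a * (M $ 1 $ 2) ^ b * (M $ 2 $ 1) ^ c * (M $ 2 $ 2) ^ d)"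

(* Zariski closure in GL_2(C) of a set of complex matrices (GL_2(C) is open in M_2(C),
   so this is the closure in M_2(C) intersected with GL_2(C)) *)
definition zariski_closure_GL2 :: "cmat set \<Rightarrow> cmat set" where
  "zariski_closure_GL2 S = {M. det M \<noteq> 0 \<and>
     (\<forall>p. is_poly4 p \<longrightarrow> (\<forall>s\<in>S. eval_poly4 p s = 0) \<longrightarrow> eval_poly4 p M = 0)}"

definition thin :: "imat set \<Rightarrow> bool" where
  "thin \<Gamma> \<longleftrightarrow>
     (let H = {A \<in> GL2Z. to_cplx A \<in> zariski_closure_GL2 (to_cplx ` \<Gamma>)}
      in infinite {(\<lambda>x. h ** x) ` \<Gamma> | h. h \<in> H})"

definition mu_thin :: "real \<Rightarrow> real" where
  "mu_thin X = real (card {g \<in> ball_X X \<times> ball_X X. thin (Gamma g)})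
               / real (card (ball_X X \<times> ball_X X))"

end

theory Submission
  imports Defs
    "HOL-Computational_Algebra.Fundamental_Theorem_Algebra"
    "HOL-Real_Asymp.Real_Asymp"
begin

text \<open>
  Let \<open>g\<close> have entries \<open>a b c d\<close>. As a Moebius map, \<open>g\<close> sends the complement of a neighbourhood
  of \<open>-d/c\<close> into a neighbourhood of \<open>a/c\<close>, because \<open>g z = a/c - 1 / (c\<^sup>2 (z + d/c))\<close>. If
  \<open>\<bar>tr g\<bar> > 2\<close>, all powers of \<open>g\<close> do this with almost the same centres, so the cyclic groups of \<open>g\<close>
  and \<open>h\<close> play ping-pong as soon as the lower left entries are large and the points \<open>a/c\<close>, \<open>-d/c\<close>
  of \<open>g\<close> are far from those of \<open>h\<close>; no separation is needed between \<open>a/c\<close> and \<open>-d/c\<close> of the same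
  matrix. Infinity lies outside all neighbourhoods, so no nontrivial element of the group fixes it,
  and the integer translations \<open>z \<mapsto> z + k\<close> lie in pairwise different cosets.

  The Zariski closure contains all translations with large \<open>k\<close>: it contains the torus \<open>D\<close> of the
  hyperbolic element \<open>g\<close>, and \<open>D h D h D\<close> contains every unimodular matrix which maps no fixed
  point of \<open>g\<close> to a fixed point of \<open>g\<close>.

  There are at least of the order of \<open>X\<^sup>2\<close> matrices in the ball (count coprime first columns).
  Those violating one of the conditions are fewer by a factor of about \<open>X\<close> to the power \<open>1/6\<close>: a
  column determines the other one up to multiples of itself, which bounds the matrices with small
  \<open>c\<close> or with \<open>a/c\<close> near a given point; and for \<open>\<bar>tr g\<bar> \<le> 2\<close> the entry \<open>c\<close> is one of the few large
  divisors of \<open>a d - 1\<close>, as three divisors close to each other have a large least common multiple.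
\<close>

section \<open>Two by two matrices\<close>

definition mat22 :: "'a::zero \<Rightarrow> 'a \<Rightarrow> 'a \<Rightarrow> 'a \<Rightarrow> 'a^2^2" where
  "mat22 a b c d = vector [vector [a, b], vector [c, d]]"

lemma mat22_nth [simp]:
  "mat22 a b c d $ 1 $ 1 = a" "mat22 a b c d $ 1 $ 2 = b"
  "mat22 a b c d $ 2 $ 1 = c" "mat22 a b c d $ 2 $ 2 = d"
  by (simp_all add: mat22_def)

lemma mat_nth_2 [simp]:
  "(mat k :: 'a::zero^2^2) $ 1 $ 1 = k" "(mat k :: 'a^2^2) $ 1 $ 2 = 0"
  "(mat k :: 'a^2^2) $ 2 $ 1 = 0" "(mat k :: 'a^2^2) $ 2 $ 2 = k"
  by (simp_all add: mat_def)

lemma mat2_eq_iff: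
  "(A::'a^2^2) = B \<longleftrightarrow> A$1$1 = B$1$1 \<and> A$1$2 = B$1$2 \<and> A$2$1 = B$2$1 \<and> A$2$2 = B$2$2"
  by (auto simp: vec_eq_iff forall_2)

lemma matrix_mult_nth_2: "((A::'a::semiring_1^2^2) ** B) $ i $ j = A$i$1 * B$1$j + A$i$2 * B$2$j"
  by (simp add: matrix_matrix_mult_def sum_2)

lemma matrix_vector_mult_nth_2: "((A::'a::semiring_1^2^2) *v x) $ i = A$i$1 * x$1 + A$i$2 * x$2"
  by (simp add: matrix_vector_mult_def sum_2)

lemma trace_2: "trace (A::'a::semiring_1^2^2) = A$1$1 + A$2$2"
  by (simp add: trace_def sum_2)

primrec matrix_power :: "'a::semiring_1^'n^'n \<Rightarrow> nat \<Rightarrow> 'a^'n^'n" where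
  "matrix_power A 0 = mat 1"
| "matrix_power A (Suc n) = A ** matrix_power A n"

lemma SL2Z_iff: "A \<in> SL2Z \<longleftrightarrow> A$1$1 * A$2$2 - A$1$2 * A$2$1 = 1"
  by (simp add: SL2Z_def det_2)

lemma one_in_SL2Z: "mat 1 \<in> SL2Z"
  by (simp add: SL2Z_def)

lemma mult_in_SL2Z: "A \<in> SL2Z \<Longrightarrow> B \<in> SL2Z \<Longrightarrow> A ** B \<in> SL2Z"
  by (simp add: SL2Z_def det_mul)

lemma matrix_power_in_SL2Z: "A \<in> SL2Z \<Longrightarrow> matrix_power A n \<in> SL2Z"
  by (induction n) (simp_all add: one_in_SL2Z mult_in_SL2Z)

lemma sl2_inv_nth [simp]:
  "sl2_inv A $ 1 $ 1 = A$2$2" "sl2_inv A $ 1 $ 2 = - A$1$2"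
  "sl2_inv A $ 2 $ 1 = - A$2$1" "sl2_inv A $ 2 $ 2 = A$1$1"
  by (simp_all add: sl2_inv_def)

lemma sl2_inv_sl2_inv [simp]: "sl2_inv (sl2_inv A) = A"
  by (simp add: mat2_eq_iff)

lemma sl2_inv_mat_1 [simp]: "sl2_inv (mat 1) = mat 1"
  by (simp add: mat2_eq_iff)

lemma sl2_inv_mult: "sl2_inv (A ** B) = sl2_inv B ** sl2_inv A"
  by (simp add: mat2_eq_iff matrix_mult_nth_2 algebra_simps)

lemma sl2_inv_in_SL2Z [simp]: "sl2_inv A \<in> SL2Z \<longleftrightarrow> A \<in> SL2Z"
  by (simp add: SL2Z_iff algebra_simps)

lemma sl2_inv_right: "A \<in> SL2Z \<Longrightarrow> A ** sl2_inv A = mat 1"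
  by (simp add: SL2Z_iff mat2_eq_iff matrix_mult_nth_2 algebra_simps)

lemma trace_sl2_inv [simp]: "trace (sl2_inv A) = trace A"
  by (simp add: trace_2)

lemma to_cplx_nth [simp]: "to_cplx A $ i $ j = of_int (A$i$j)"
  by (simp add: to_cplx_def)

lemma to_cplx_mult: "to_cplx (A ** B) = to_cplx A ** to_cplx B"
  by (simp add: mat2_eq_iff matrix_mult_nth_2)

lemma to_cplx_mat_1 [simp]: "to_cplx (mat 1) = mat 1"
  by (simp add: mat2_eq_iff)

lemma to_cplx_matrix_power: "to_cplx (matrix_power A n) = matrix_power (to_cplx A) n"
  by (induction n) (simp_all add: to_cplx_mult)

lemma det_to_cplx: "det (to_cplx A) = of_int (det A)"
  by (simp add: det_2)

lemma gen_group_left_induct [consumes 1, case_names one left left_inv]: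
  assumes "a \<in> gen_group S"
    and one: "P (mat 1)"
    and left: "\<And>s w. s \<in> S \<Longrightarrow> P w \<Longrightarrow> P (s ** w)"
    and left_inv: "\<And>s w. s \<in> S \<Longrightarrow> P w \<Longrightarrow> P (sl2_inv s ** w)"
  shows "P a"
proof -
  have "\<forall>w. P w \<longrightarrow> P (a ** w) \<and> P (sl2_inv a ** w)"
    using assms(1)
    by induction (simp_all add: left left_inv sl2_inv_mult flip: matrix_mul_assoc)
  then show ?thesis using one by force
qed

section \<open>Ping-pong\<close>

inductive alternating_word ::
  "('a::semiring_1^'n^'n) set \<Rightarrow> ('a^'n^'n) set \<Rightarrow> 'a^'n^'n \<Rightarrow> bool" where
  single: "a \<in> A \<Longrightarrow> a \<noteq> mat 1 \<Longrightarrow> alternating_word A B a"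
| prepend: "a \<in> A \<Longrightarrow> a \<noteq> mat 1 \<Longrightarrow> alternating_word B A w \<Longrightarrow> alternating_word A B (a ** w)"

definition alternating_words ::
  "('a::semiring_1^'n^'n) set \<Rightarrow> ('a^'n^'n) set \<Rightarrow> ('a^'n^'n) set" where
  "alternating_words A B = {w. w = mat 1 \<or> alternating_word A B w \<or> alternating_word B A w}"

lemma alternating_words_commute: "alternating_words A B = alternating_words B A"
  by (auto simp: alternating_words_def)

lemma one_in_alternating_words: "mat 1 \<in> alternating_words A B"
  by (simp add: alternating_words_def)

lemma left_mult_in_alternating_words:
  assumes one: "mat 1 \<in> A" and closed: "\<And>a. a \<in> A \<Longrightarrow> s ** a \<in> A"
    and w: "w \<in> alternating_words A B"
  shows "s ** w \<in> alternating_words A B"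
proof -
  have s: "s \<in> A" using closed[OF one] by simp
  consider "w = mat 1" | "alternating_word B A w" | "alternating_word A B w"
    using w by (auto simp: alternating_words_def)
  then show ?thesis
  proof cases
    case 1
    then show ?thesis
      using s by (auto simp: alternating_words_def intro: alternating_word.intros)
  next
    case 2
    then show ?thesis
      using s
      by (cases "s = mat 1") (auto simp: alternating_words_def intro: alternating_word.intros)
  next
    case 3
    then show ?thesis
    proof cases
      case single
      then show ?thesis
        using closed by (auto simp: alternating_words_def intro: alternating_word.intros)
    next
      case (prepend a v)
      have "s ** w = (s ** a) ** v" using prepend(1) by (simp add: matrix_mul_assoc)
      then show ?thesis
        using prepend closed[OF prepend(2)]
        by (cases "s ** a = mat 1")
          (auto simp: alternating_words_def intro: alternating_word.intros)
    qed
  qed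
qed

definition pushes_into :: "imat set \<Rightarrow> (complex^2) set \<Rightarrow> bool" where
  "pushes_into A U \<longleftrightarrow> (\<forall>a\<in>A. \<forall>v. a \<noteq> mat 1 \<longrightarrow> v \<noteq> 0 \<longrightarrow> v \<notin> U \<longrightarrow> to_cplx a *v v \<in> U)"

lemma pushes_intoD:
  "pushes_into A U \<Longrightarrow> a \<in> A \<Longrightarrow> a \<noteq> mat 1 \<Longrightarrow> v \<noteq> 0 \<Longrightarrow> v \<notin> U \<Longrightarrow> to_cplx a *v v \<in> U"
  by (simp add: pushes_into_def)

lemma ping_pong:
  assumes "alternating_word A B w" "pushes_into A U" "pushes_into B V" "U \<inter> V = {}"
    and "0 \<notin> U" "0 \<notin> V" "v \<noteq> 0" "v \<notin> U" "v \<notin> V"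
  shows "to_cplx w *v v \<in> U"
  using assms
proof (induction arbitrary: U V rule: alternating_word.induct)
  case (single a A B)
  then show ?case by (simp add: pushes_intoD)
next
  case (prepend a A B w)
  have "to_cplx w *v v \<in> V" using prepend by blast
  then have "to_cplx a *v (to_cplx w *v v) \<in> U"
    using prepend by (intro pushes_intoD[of A]) auto
  then show ?case by (simp add: to_cplx_mult matrix_vector_mul_assoc)
qed

definition cyclic_group :: "imat \<Rightarrow> imat set" where
  "cyclic_group g = range (matrix_power g) \<union> range (matrix_power (sl2_inv g))"

lemma one_in_cyclic_group: "mat 1 \<in> cyclic_group g"
  unfolding cyclic_group_def by (metis UnI1 matrix_power.simps(1) rangeI)

lemma cyclic_group_sl2_inv [simp]: "cyclic_group (sl2_inv g) = cyclic_group g"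
  by (auto simp: cyclic_group_def)

lemma cyclic_group_cases:
  assumes "a \<in> cyclic_group g"
  obtains "a = mat 1" | n where "a = matrix_power g (Suc n)"
    | n where "a = matrix_power (sl2_inv g) (Suc n)"
proof -
  obtain n where n: "a = matrix_power g n \<or> a = matrix_power (sl2_inv g) n"
    using assms by (auto simp: cyclic_group_def)
  show thesis
  proof (cases n)
    case 0
    then show thesis using n that(1) by auto
  next
    case (Suc k)
    then show thesis using n that(2,3) by blast
  qed
qed

lemma left_mult_in_cyclic_group:
  assumes g: "g \<in> SL2Z" and a: "a \<in> cyclic_group g"
  shows "g ** a \<in> cyclic_group g"
proof -
  consider n where "a = matrix_power g n" | n where "a = matrix_power (sl2_inv g) (Suc n)"
    using a by (elim cyclic_group_cases) (metis matrix_power.simps)+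
  then show ?thesis
  proof cases
    case 1
    then have "g ** a = matrix_power g (Suc n)" by simp
    then show ?thesis unfolding cyclic_group_def by blast
  next
    case 2
    then have "g ** a = matrix_power (sl2_inv g) n"
      by (simp add: matrix_mul_assoc sl2_inv_right[OF g])
    then show ?thesis unfolding cyclic_group_def by blast
  qed
qed

lemma self_in_cyclic_group: "g \<in> SL2Z \<Longrightarrow> g \<in> cyclic_group g"
  using left_mult_in_cyclic_group[OF _ one_in_cyclic_group] by simp

lemma Gamma_subset_alternating_words:
  assumes g: "g \<in> SL2Z" and h: "h \<in> SL2Z"
  shows "Gamma (g, h) \<subseteq> alternating_words (cyclic_group g) (cyclic_group h)"
proof
  let ?W = "alternating_words (cyclic_group g) (cyclic_group h)"
  have mult: "s ** w \<in> ?W" if "s \<in> {g, sl2_inv g, h, sl2_inv h}" "w \<in> ?W" for s w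
  proof -
    have "s ** a \<in> cyclic_group g" if "s \<in> {g, sl2_inv g}" "a \<in> cyclic_group g" for s a
      using that g left_mult_in_cyclic_group[of s] by auto
    moreover have "s ** a \<in> cyclic_group h" if "s \<in> {h, sl2_inv h}" "a \<in> cyclic_group h" for s a
      using that h left_mult_in_cyclic_group[of s] by auto
    ultimately show ?thesis
      using that left_mult_in_alternating_words[OF one_in_cyclic_group, of g s w "cyclic_group h"]
        left_mult_in_alternating_words[OF one_in_cyclic_group, of h s w "cyclic_group g"]
      by (auto simp: alternating_words_commute)
  qed
  fix a
  assume "a \<in> Gamma (g, h)"
  then show "a \<in> ?W"
    unfolding Gamma_def
  proof (induction rule: gen_group_left_induct)
    case one
    show ?case by (rule one_in_alternating_words)
  next
    case (left s w)
    then show ?case by (intro mult) auto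
  next
    case (left_inv s w)
    then show ?case by (intro mult) auto
  qed
qed

section \<open>Schottky pairs\<close>

text \<open>A vector \<open>v\<close> represents the point \<open>v\<^sub>1 / v\<^sub>2\<close> of the Riemann sphere, so no slope ball contains
  infinity.\<close>

definition slope_ball :: "real \<Rightarrow> real \<Rightarrow> (complex^2) set" where
  "slope_ball r x = {v. norm (v$1 - of_real x * v$2) < r * norm (v$2)}"

lemma zero_notin_slope_ball [simp]: "0 \<notin> slope_ball r x"
  by (simp add: slope_ball_def)

lemma slope_ball_scale [simp]:
  assumes "k \<noteq> 0"
  shows "k *s v \<in> slope_ball r x \<longleftrightarrow> v \<in> slope_ball r x"
proof -
  have "k * v$1 - of_real x * (k * v$2) = k * (v$1 - of_real x * v$2)" by (simp add: algebra_simps)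
  then have "norm (k * v$1 - of_real x * (k * v$2)) = norm k * norm (v$1 - of_real x * v$2)"
    by (simp only: norm_mult)
  then show ?thesis using assms by (simp add: slope_ball_def norm_mult)
qed

lemma disjoint_slope_balls:
  assumes "2 * r \<le> \<bar>x - y\<bar>"
  shows "slope_ball r x \<inter> slope_ball r y = {}"
proof -
  have False if v: "v \<in> slope_ball r x" "v \<in> slope_ball r y" for v
  proof -
    have "2 * r * norm (v$2) \<le> \<bar>x - y\<bar> * norm (v$2)" using assms by (intro mult_right_mono) auto
    also have "\<dots> = norm (of_real (x - y) * v$2)" unfolding norm_mult norm_of_real ..
    also have "of_real (x - y) * v$2 = (v$1 - of_real y * v$2) - (v$1 - of_real x * v$2)"
      by (simp add: algebra_simps)
    also have "norm \<dots> \<le> norm (v$1 - of_real y * v$2) + norm (v$1 - of_real x * v$2)"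
      by (rule norm_triangle_ineq4)
    also have "\<dots> < 2 * r * norm (v$2)" using v by (simp add: slope_ball_def)
    finally show False by simp
  qed
  then show ?thesis by blast
qed

definition image_of_infinity :: "imat \<Rightarrow> real" where
  "image_of_infinity g = of_int (g$1$1) / of_int (g$2$1)"

definition ping_pong_domain :: "real \<Rightarrow> imat \<Rightarrow> (complex^2) set" where
  "ping_pong_domain r g =
     slope_ball r (image_of_infinity g) \<union> slope_ball r (image_of_infinity (sl2_inv g))"

lemma ping_pong_domain_sl2_inv [simp]: "ping_pong_domain r (sl2_inv g) = ping_pong_domain r g"
  by (auto simp: ping_pong_domain_def)

lemma zero_notin_ping_pong_domain [simp]: "0 \<notin> ping_pong_domain r g"
  by (simp add: ping_pong_domain_def)

lemma ping_pong_domain_scale [simp]: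
  "k \<noteq> 0 \<Longrightarrow> k *s v \<in> ping_pong_domain r g \<longleftrightarrow> v \<in> ping_pong_domain r g"
  by (simp add: ping_pong_domain_def)

lemma disjoint_ping_pong_domains:
  assumes "\<And>a b. a \<in> {g, sl2_inv g} \<Longrightarrow> b \<in> {h, sl2_inv h} \<Longrightarrow>
    2 * r \<le> \<bar>image_of_infinity a - image_of_infinity b\<bar>"
  shows "ping_pong_domain r g \<inter> ping_pong_domain r h = {}"
  using assms[THEN disjoint_slope_balls] unfolding ping_pong_domain_def by blast

text \<open>The inequality is what lets all powers of \<open>g\<close> contract towards almost the same point.\<close>

lemma matrix_power_Suc_eq_linear:
  assumes g: "g \<in> SL2Z" and tr: "2 < \<bar>trace g\<bar>"
  shows "\<exists>x y. \<bar>y\<bar> < \<bar>x\<bar> \<and> matrix_power g (Suc n) = mat x ** g - mat y"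
proof (induction n)
  case 0
  have "matrix_power g (Suc 0) = mat 1 ** g - mat 0" by (simp add: mat2_eq_iff)
  moreover have "\<bar>0::int\<bar> < \<bar>1\<bar>" by simp
  ultimately show ?case by blast
next
  case (Suc n)
  obtain x y where xy: "\<bar>y\<bar> < \<bar>x\<bar>" and power: "matrix_power g (Suc n) = mat x ** g - mat y"
    using Suc by blast
  have "3 * \<bar>x\<bar> \<le> \<bar>trace g\<bar> * \<bar>x\<bar>" using tr by (intro mult_right_mono) auto
  then have "\<bar>x\<bar> < \<bar>trace g * x - y\<bar>" using xy unfolding abs_mult[symmetric] by linarith
  moreover have "matrix_power g (Suc (Suc n)) = mat (trace g * x - y) ** g - mat x"
  proof -
    have "g$1$2 * g$2$1 = g$1$1 * g$2$2 - 1" using g by (simp add: SL2Z_iff)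
    then have "g ** (mat x ** g - mat y) = mat (trace g * x - y) ** g - mat x"
      by (simp add: mat2_eq_iff matrix_mult_nth_2 trace_2) algebra
    then show ?thesis using power by simp
  qed
  ultimately show ?case by blast
qed

lemma moebius_contracts:
  fixes a b c d x y p q :: "'a::real_normed_field"
  assumes det: "a * d - b * c = 1"
    and det_power: "(x * a - y) * (x * d - y) - (x * b) * (x * c) = 1"
    and xy: "norm y < norm x" "1 \<le> norm x" and c: "2 \<le> r * norm c"
    and pq: "p \<noteq> 0 \<or> q \<noteq> 0" "r * norm q \<le> norm (p + d / c * q)"
  defines "p' \<equiv> (x * a - y) * p + x * b * q" and "q' \<equiv> x * c * p + (x * d - y) * q"
  shows "norm (p' - a / c * q') < r * norm q'"
proof -
  define s where "s = c * p + d * q"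
  have c0: "c \<noteq> 0" using c by auto
  have norm_x: "norm z \<le> norm x * norm z" for z :: 'a
    using mult_right_mono[OF xy(2), of "norm z"] by simp
  have s: "2 * norm q \<le> norm s" "s \<noteq> 0"
  proof -
    have "2 * norm q \<le> r * norm c * norm q" using c by (intro mult_right_mono) auto
    also have "\<dots> \<le> norm c * norm (p + d / c * q)"
      using mult_left_mono[OF pq(2), of "norm c"] by (simp add: mult_ac)
    also have "\<dots> = norm s" using c0 by (simp add: s_def distrib_left flip: norm_mult)
    finally show "2 * norm q \<le> norm s" .
    then show "s \<noteq> 0" using pq(1) c0 by (auto simp: s_def)
  qed
  have q': "norm q \<le> norm q'" "0 < norm q'"
  proof -
    have "norm y * (2 * norm q) \<le> norm x * norm s" using xy s by (intro mult_mono) auto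
    moreover have "q' = x * s - y * q" by (simp add: q'_def s_def algebra_simps)
    then have "norm x * norm s - norm y * norm q \<le> norm q'"
      by (metis norm_mult norm_triangle_ineq2)
    moreover have "0 < norm s" using s(2) by simp
    ultimately show "norm q \<le> norm q'" "0 < norm q'" using s(1) norm_x[of s] by linarith+
  qed
  have "x * (c * p' - a * q') = - (q + y * q')"
    unfolding p'_def q'_def using det det_power by algebra
  then have "norm x * norm (c * p' - a * q') = norm (q + y * q')"
    by (metis norm_minus_cancel norm_mult)
  also have "\<dots> \<le> norm q + norm y * norm q'" by (metis norm_mult norm_triangle_ineq)
  also have "\<dots> < norm q' + norm x * norm q'"
    using q' xy by (intro add_le_less_mono mult_strict_right_mono) auto
  also have "\<dots> \<le> norm x * (2 * norm q')" using norm_x[of q'] by linarith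
  finally have "norm (c * p' - a * q') < 2 * norm q'"
    by (rule mult_left_less_imp_less) simp
  also have "\<dots> \<le> r * norm c * norm q'" using c by (intro mult_right_mono) auto
  also have "c * p' - a * q' = c * (p' - a / c * q')" using c0 by (simp add: field_simps)
  finally show ?thesis using c0 by (simp add: norm_mult)
qed

lemma linear_combination_contracts:
  assumes g: "g \<in> SL2Z" and c: "2 \<le> r * \<bar>real_of_int (g$2$1)\<bar>" and xy: "\<bar>y\<bar> < \<bar>x\<bar>"
    and m: "m = mat x ** g - mat y" "m \<in> SL2Z"
    and v: "v \<noteq> 0" "v \<notin> slope_ball r (image_of_infinity (sl2_inv g))"
  shows "to_cplx m *v v \<in> slope_ball r (image_of_infinity g)"
proof -
  define a b c d where abcd: "a = complex_of_int (g$1$1)" "b = complex_of_int (g$1$2)"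
    "c = complex_of_int (g$2$1)" "d = complex_of_int (g$2$2)"
  define X Y where XY: "X = complex_of_int x" "Y = complex_of_int y"
  have "complex_of_int (g$1$1 * g$2$2 - g$1$2 * g$2$1) = 1"
    using g by (simp only: SL2Z_iff of_int_1)
  then have det: "a * d - b * c = 1" by (simp add: abcd)
  have "complex_of_int (m$1$1 * m$2$2 - m$1$2 * m$2$1) = 1"
    using m(2) by (simp only: SL2Z_iff of_int_1)
  then have det_power: "(X * a - Y) * (X * d - Y) - (X * b) * (X * c) = 1"
    by (simp add: m(1) abcd XY matrix_mult_nth_2)
  have "norm ((X * a - Y) * v$1 + X * b * v$2 - a / c * (X * c * v$1 + (X * d - Y) * v$2))
      < r * norm (X * c * v$1 + (X * d - Y) * v$2)"
  proof (rule moebius_contracts[OF det det_power])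
    show "norm Y < norm X" "1 \<le> norm X" using xy by (auto simp: XY)
    show "2 \<le> r * norm c" using \<open>2 \<le> r * _\<close> by (simp add: abcd)
    show "v$1 \<noteq> 0 \<or> v$2 \<noteq> 0" using v(1) by (auto simp: vec_eq_iff forall_2)
    show "r * norm (v$2) \<le> norm (v$1 + d / c * v$2)"
      using v(2) by (simp add: slope_ball_def image_of_infinity_def abcd not_less)
  qed
  then show ?thesis
    by (simp add: slope_ball_def image_of_infinity_def m(1) abcd XY
        matrix_vector_mult_nth_2 matrix_mult_nth_2)
qed

definition ping_pong_generator :: "real \<Rightarrow> imat \<Rightarrow> bool" where
  "ping_pong_generator r g \<longleftrightarrow> g \<in> SL2Z \<and> 2 < \<bar>trace g\<bar> \<and> 2 \<le> r * \<bar>real_of_int (g$2$1)\<bar>"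

lemma ping_pong_generator_sl2_inv [simp]:
  "ping_pong_generator r (sl2_inv g) = ping_pong_generator r g"
  by (simp add: ping_pong_generator_def)

lemma matrix_power_pushes_into:
  assumes "ping_pong_generator r g" "v \<noteq> 0" "v \<notin> ping_pong_domain r g"
  shows "to_cplx (matrix_power g (Suc n)) *v v \<in> ping_pong_domain r g"
proof -
  have g: "g \<in> SL2Z" "2 < \<bar>trace g\<bar>" "2 \<le> r * \<bar>real_of_int (g$2$1)\<bar>"
    using assms(1) by (auto simp: ping_pong_generator_def)
  obtain x y where xy: "\<bar>y\<bar> < \<bar>x\<bar>" "matrix_power g (Suc n) = mat x ** g - mat y"
    using matrix_power_Suc_eq_linear[OF g(1,2)] by blast
  show ?thesis
    using linear_combination_contracts[OF g(1,3) xy matrix_power_in_SL2Z[OF g(1)] assms(2)] assms(3)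
    by (simp add: ping_pong_domain_def)
qed

lemma cyclic_group_pushes_into:
  assumes g: "ping_pong_generator r g"
  shows "pushes_into (cyclic_group g) (ping_pong_domain r g)"
  unfolding pushes_into_def
proof (intro ballI allI impI)
  fix a and v :: "complex^2"
  assume "a \<in> cyclic_group g" "a \<noteq> mat 1" and v: "v \<noteq> 0" "v \<notin> ping_pong_domain r g"
  then consider n where "a = matrix_power g (Suc n)"
    | n where "a = matrix_power (sl2_inv g) (Suc n)"
    by (elim cyclic_group_cases) auto
  then show "to_cplx a *v v \<in> ping_pong_domain r g"
    using matrix_power_pushes_into[of r g] matrix_power_pushes_into[of r "sl2_inv g"] g v
    by cases auto
qed

definition schottky_pair :: "real \<Rightarrow> imat \<Rightarrow> imat \<Rightarrow> bool" where
  "schottky_pair r g h \<longleftrightarrow> ping_pong_generator r g \<and> ping_pong_generator r h \<and>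
     ping_pong_domain r g \<inter> ping_pong_domain r h = {}"

lemma schottky_pair_stabilizer_of_infinity:
  assumes gh: "schottky_pair r g h" and a: "a \<in> Gamma (g, h)" "a$2$1 = 0"
  shows "a = mat 1"
proof (rule ccontr)
  define e :: "complex^2" where "e = axis 1 1"
  assume "a \<noteq> mat 1"
  then have "alternating_word (cyclic_group g) (cyclic_group h) a \<or>
      alternating_word (cyclic_group h) (cyclic_group g) a"
    using a(1) gh Gamma_subset_alternating_words[of g h]
    by (auto simp: schottky_pair_def ping_pong_generator_def alternating_words_def)
  moreover have "e \<noteq> 0" "e \<notin> ping_pong_domain r x" for x
    by (simp_all add: e_def ping_pong_domain_def slope_ball_def axis_def vec_eq_iff)
  ultimately have "to_cplx a *v e \<in> ping_pong_domain r g \<union> ping_pong_domain r h"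
    using gh cyclic_group_pushes_into ping_pong[where v = e and w = a] unfolding schottky_pair_def
    by (metis Int_commute UnI1 UnI2 zero_notin_ping_pong_domain)
  then show False
    using a(2)
    by (auto simp: ping_pong_domain_def slope_ball_def e_def axis_def matrix_vector_mult_nth_2)
qed

section \<open>Zariski closure\<close>

definition laurent_polynomial :: "(complex \<Rightarrow> complex) \<Rightarrow> bool" where
  "laurent_polynomial f \<longleftrightarrow> (\<exists>p n. \<forall>t. t \<noteq> 0 \<longrightarrow> f t * t ^ n = poly p t)"

lemma laurent_polynomial_const: "laurent_polynomial (\<lambda>t. k)"
  unfolding laurent_polynomial_def by (rule exI[of _ "[:k:]"], rule exI[of _ 0]) simp

lemma laurent_polynomial_ident: "laurent_polynomial (\<lambda>t. t)"
  unfolding laurent_polynomial_def by (rule exI[of _ "[:0, 1:]"], rule exI[of _ 0]) simp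

lemma laurent_polynomial_inverse: "laurent_polynomial (\<lambda>t. 1 / t)"
  unfolding laurent_polynomial_def by (rule exI[of _ "[:1:]"], rule exI[of _ 1]) simp

lemma laurent_polynomial_mult:
  assumes "laurent_polynomial f" "laurent_polynomial g"
  shows "laurent_polynomial (\<lambda>t. f t * g t)"
proof -
  obtain p m q n where pq: "\<And>t. t \<noteq> 0 \<Longrightarrow> f t * t ^ m = poly p t" "\<And>t. t \<noteq> 0 \<Longrightarrow> g t * t ^ n = poly q t"
    using assms unfolding laurent_polynomial_def by metis
  have "f t * g t * t ^ (m + n) = poly (p * q) t" if "t \<noteq> 0" for t
    using pq[OF that, symmetric] by (simp add: power_add algebra_simps)
  then show ?thesis unfolding laurent_polynomial_def by blast
qed

lemma laurent_polynomial_add: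
  assumes "laurent_polynomial f" "laurent_polynomial g"
  shows "laurent_polynomial (\<lambda>t. f t + g t)"
proof -
  obtain p m q n where pq: "\<And>t. t \<noteq> 0 \<Longrightarrow> f t * t ^ m = poly p t" "\<And>t. t \<noteq> 0 \<Longrightarrow> g t * t ^ n = poly q t"
    using assms unfolding laurent_polynomial_def by metis
  have "(f t + g t) * t ^ (m + n) = poly (p * monom 1 n + q * monom 1 m) t" if "t \<noteq> 0" for t
    using pq[OF that, symmetric] by (simp add: power_add poly_monom algebra_simps)
  then show ?thesis unfolding laurent_polynomial_def by blast
qed

lemma laurent_polynomial_power: "laurent_polynomial f \<Longrightarrow> laurent_polynomial (\<lambda>t. f t ^ n)"
  by (induction n) (auto intro: laurent_polynomial_const laurent_polynomial_mult)

lemma laurent_polynomial_sum: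
  "(\<And>i. i \<in> I \<Longrightarrow> laurent_polynomial (f i)) \<Longrightarrow> laurent_polynomial (\<lambda>t. \<Sum>i\<in>I. f i t)"
  by (induction I rule: infinite_finite_induct)
    (auto intro: laurent_polynomial_const laurent_polynomial_add)

lemma laurent_polynomial_eq_0:
  assumes f: "laurent_polynomial f" and S: "infinite S" "\<And>s. s \<in> S \<Longrightarrow> s \<noteq> 0 \<and> f s = 0"
    and t: "t \<noteq> 0"
  shows "f t = 0"
proof -
  obtain p n where p: "\<And>t. t \<noteq> 0 \<Longrightarrow> f t * t ^ n = poly p t"
    using f unfolding laurent_polynomial_def by metis
  have "S \<subseteq> {s. poly p s = 0}" using S(2) p by force
  then have "p = 0" using S(1) poly_roots_finite finite_subset by blast
  then show ?thesis using p[OF t] t by simp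
qed

definition laurent_matrix :: "(complex \<Rightarrow> cmat) \<Rightarrow> bool" where
  "laurent_matrix F \<longleftrightarrow> (\<forall>i j. laurent_polynomial (\<lambda>t. F t $ i $ j))"

lemma laurent_matrix_const: "laurent_matrix (\<lambda>t. A)"
  by (simp add: laurent_matrix_def laurent_polynomial_const)

lemma laurent_matrix_mult:
  "laurent_matrix F \<Longrightarrow> laurent_matrix G \<Longrightarrow> laurent_matrix (\<lambda>t. F t ** G t)"
  by (auto simp: laurent_matrix_def matrix_mult_nth_2
      intro!: laurent_polynomial_add laurent_polynomial_mult)

lemma laurent_polynomial_eval_poly4:
  "laurent_matrix F \<Longrightarrow> laurent_polynomial (\<lambda>t. eval_poly4 p (F t))"
  unfolding eval_poly4_def laurent_matrix_def
  by (intro laurent_polynomial_sum)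
    (auto simp: split_def
      intro!: laurent_polynomial_mult laurent_polynomial_power laurent_polynomial_const)

definition unimodular_diag :: "complex \<Rightarrow> cmat" where
  "unimodular_diag t = mat22 t 0 0 (1 / t)"

lemma unimodular_diag_nth [simp]:
  "unimodular_diag t $ 1 $ 1 = t" "unimodular_diag t $ 1 $ 2 = 0"
  "unimodular_diag t $ 2 $ 1 = 0" "unimodular_diag t $ 2 $ 2 = 1 / t"
  by (simp_all add: unimodular_diag_def)

lemma laurent_matrix_unimodular_diag: "laurent_matrix unimodular_diag"
  by (simp add: laurent_matrix_def forall_2 laurent_polynomial_const laurent_polynomial_ident
      laurent_polynomial_inverse)

lemma det_unimodular_diag: "t \<noteq> 0 \<Longrightarrow> det (unimodular_diag t) = 1"
  by (simp add: det_2)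

lemma unimodular_diag_mult: "unimodular_diag s ** unimodular_diag t = unimodular_diag (s * t)"
  by (simp add: mat2_eq_iff matrix_mult_nth_2)

lemma matrix_power_conjugate_diag:
  fixes P Q :: cmat
  assumes QP: "Q ** P = mat 1" and G: "G = P ** unimodular_diag l ** Q"
  shows "matrix_power G n = P ** unimodular_diag (l ^ n) ** Q"
proof (induction n)
  case 0
  have "unimodular_diag 1 = mat 1" by (simp add: mat2_eq_iff)
  moreover have "P ** Q = mat 1" using QP by (simp only: matrix_left_right_inverse[of P])
  ultimately show ?case by simp
next
  case (Suc n)
  have "matrix_power G (Suc n)
      = P ** unimodular_diag l ** (Q ** P) ** unimodular_diag (l ^ n) ** Q"
    unfolding matrix_power.simps Suc by (simp add: G matrix_mul_assoc)
  also have "\<dots> = P ** (unimodular_diag l ** unimodular_diag (l ^ n)) ** Q"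
    by (simp add: QP matrix_mul_assoc)
  finally show ?case by (simp add: unimodular_diag_mult)
qed

lemma inj_power_if_norm_neq_1:
  fixes l :: "'a::real_normed_div_algebra"
  assumes "l \<noteq> 0" "norm l \<noteq> 1"
  shows "inj (\<lambda>n::nat. l ^ n)"
proof (rule injI)
  fix m n :: nat
  assume "l ^ m = l ^ n"
  then have "norm l ^ m = norm l ^ n" by (metis norm_power)
  then show "m = n"
    using assms power_inject_exp' by (metis zero_less_norm_iff)
qed

lemma subset_zariski_closure_GL2: "M \<in> S \<Longrightarrow> det M \<noteq> 0 \<Longrightarrow> M \<in> zariski_closure_GL2 S"
  by (simp add: zariski_closure_GL2_def)

lemma torus_in_zariski_closure:
  fixes P Q :: cmat
  assumes QP: "Q ** P = mat 1" and G: "G = P ** unimodular_diag l ** Q"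
    and l: "l \<noteq> 0" "norm l \<noteq> 1"
    and powers: "\<And>n. A ** matrix_power G n ** B \<in> zariski_closure_GL2 S" and t: "t \<noteq> 0"
  shows "A ** (P ** unimodular_diag t ** Q) ** B \<in> zariski_closure_GL2 S"
proof -
  define F where "F t = A ** (P ** unimodular_diag t ** Q) ** B" for t
  have F_power: "F (l ^ n) \<in> zariski_closure_GL2 S" for n
    using powers[of n] by (simp add: F_def matrix_power_conjugate_diag[OF QP G])
  have "eval_poly4 p (F t) = 0" if p: "is_poly4 p" "\<forall>s\<in>S. eval_poly4 p s = 0" for p
  proof (rule laurent_polynomial_eq_0[where f = "\<lambda>t. eval_poly4 p (F t)"
        and S = "range (\<lambda>n::nat. l ^ n)"])
    show "laurent_polynomial (\<lambda>t. eval_poly4 p (F t))"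
      unfolding F_def
      by (intro laurent_polynomial_eval_poly4 laurent_matrix_mult laurent_matrix_const
          laurent_matrix_unimodular_diag)
    show "infinite (range (\<lambda>n::nat. l ^ n))"
      by (intro range_inj_infinite inj_power_if_norm_neq_1 l)
    show "s \<noteq> 0 \<and> eval_poly4 p (F s) = 0" if "s \<in> range (\<lambda>n::nat. l ^ n)" for s
      using that l F_power p by (auto simp: zariski_closure_GL2_def)
  qed (rule t)
  moreover have "det (F t) = det (F (l ^ 0))"
    using t by (simp add: F_def det_mul det_unimodular_diag)
  then have "det (F t) \<noteq> 0" using F_power[of 0] by (simp add: zariski_closure_GL2_def)
  ultimately show ?thesis by (simp add: zariski_closure_GL2_def F_def)
qed

lemma quadratic_root_exists:
  fixes A B C :: complex
  assumes "A \<noteq> 0"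
  obtains u where "A * u\<^sup>2 + B * u + C = 0"
proof -
  have "\<not> constant (poly [:C, B, A:])" using assms by (simp add: constant_degree)
  then obtain u where "poly [:C, B, A:] u = 0" using fundamental_theorem_of_algebra by blast
  then show ?thesis by (intro that[of u]) (simp add: power2_eq_square algebra_simps)
qed

lemma diagonal_product_surjective:
  fixes h :: cmat
  assumes h: "\<And>i j. h$i$j \<noteq> 0"
  obtains t where "t \<noteq> 0"
    "(h ** unimodular_diag t ** h)$1$1 * (h ** unimodular_diag t ** h)$2$2 = k"
proof -
  define a b c d where abcd: "a = h$1$1" "b = h$1$2" "c = h$2$1" "d = h$2$2"
  have nz: "a \<noteq> 0" "b \<noteq> 0" "c \<noteq> 0" "d \<noteq> 0" using h by (simp_all add: abcd)
  obtain u where u: "(a\<^sup>2 * b * c) * u\<^sup>2 + (a\<^sup>2 * d\<^sup>2 + b\<^sup>2 * c\<^sup>2 - k) * u + b * c * d\<^sup>2 = 0"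
    using quadratic_root_exists[of "a\<^sup>2 * b * c"] nz by auto
  then have u0: "u \<noteq> 0" using nz by auto
  define t where "t = csqrt u"
  have t: "t\<^sup>2 = u" "t \<noteq> 0" using u0 by (auto simp: t_def)
  have "t\<^sup>2 * ((a * t * a + b / t * c) * (c * t * b + d / t * d))
      = (a\<^sup>2 * u + b * c) * (b * c * u + d\<^sup>2)"
    using t(2) by (simp add: t(1)[symmetric] field_simps power2_eq_square)
  also have "\<dots> = t\<^sup>2 * k" using u unfolding t(1) by algebra
  finally have "(a * t * a + b / t * c) * (c * t * b + d / t * d) = k" using t(2) by simp
  then show ?thesis
    using t(2) that[of t] by (simp add: matrix_mult_nth_2 abcd)
qed

lemma diag_double_coset:
  fixes m n :: cmat
  assumes det: "det m = 1" "det n = 1" and m: "\<And>i j. m$i$j \<noteq> 0" and n: "\<And>i j. n$i$j \<noteq> 0"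
    and diag: "m$1$1 * m$2$2 = n$1$1 * n$2$2"
  obtains s s' where "s \<noteq> 0" "s' \<noteq> 0" "m = unimodular_diag s ** n ** unimodular_diag s'"
proof -
  define s where "s = csqrt (m$1$1 / n$1$1 * (m$1$2 / n$1$2))"
  define s' where "s' = m$1$1 / n$1$1 / s"
  have s2: "s * s = m$1$1 / n$1$1 * (m$1$2 / n$1$2)"
    unfolding s_def by (metis power2_csqrt power2_eq_square)
  then have s0: "s \<noteq> 0" "s' \<noteq> 0" using m n by (auto simp: s'_def)
  have product: "s * s' = m$1$1 / n$1$1" using s0 by (simp add: s'_def)
  have "s / s' = s * s / (m$1$1 / n$1$1)" using s0 by (simp add: s'_def)
  then have quotient: "s / s' = m$1$2 / n$1$2" unfolding s2 using m n by simp
  have "m$1$2 * m$2$1 = n$1$2 * n$2$1" using det diag unfolding det_2 by algebra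
  then have "m$2$1 = n$2$1 / (s / s')" unfolding quotient using m n by (simp add: field_simps)
  moreover have "m$2$2 = n$2$2 / (s * s')"
    unfolding product using diag m n by (simp add: field_simps)
  moreover have "m$1$1 = s * s' * n$1$1" "m$1$2 = s / s' * n$1$2"
    unfolding product quotient using n by simp_all
  ultimately have "m = unimodular_diag s ** n ** unimodular_diag s'"
    unfolding mat2_eq_iff by (simp add: matrix_mult_nth_2)
  then show ?thesis using s0 that by blast
qed

lemma diag_factorization:
  fixes h m :: cmat
  assumes det: "det h = 1" "det m = 1" and h: "\<And>i j. h$i$j \<noteq> 0" and m: "\<And>i j. m$i$j \<noteq> 0"
  obtains s t s' where "s \<noteq> 0" "t \<noteq> 0" "s' \<noteq> 0"
    "m = unimodular_diag s ** h ** unimodular_diag t ** h ** unimodular_diag s'"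
proof -
  obtain t where t: "t \<noteq> 0"
    and diag: "(h ** unimodular_diag t ** h)$1$1 * (h ** unimodular_diag t ** h)$2$2
      = m$1$1 * m$2$2"
    by (rule diagonal_product_surjective[OF h])
  define n where "n = h ** unimodular_diag t ** h"
  have det_n: "det n = 1" using det t by (simp add: n_def det_mul det_unimodular_diag)
  have "n$1$1 * n$2$2 = m$1$1 * m$2$2" using diag by (simp add: n_def)
  moreover from this have "n$1$2 * n$2$1 = m$1$2 * m$2$1" using det det_n unfolding det_2 by algebra
  ultimately have "\<forall>i j. n$i$j \<noteq> 0" unfolding forall_2 using m by (metis mult_eq_0_iff)
  then obtain s s' where "s \<noteq> 0" "s' \<noteq> 0" "m = unimodular_diag s ** n ** unimodular_diag s'"
    using diag_double_coset[OF det(2) det_n m] diag unfolding n_def by metis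
  then show ?thesis using t that by (simp add: n_def matrix_mul_assoc)
qed

lemma torus_words_in_zariski_closure:
  fixes P Q :: cmat
  assumes QP: "Q ** P = mat 1" and G: "G = P ** unimodular_diag l ** Q"
    and l: "l \<noteq> 0" "norm l \<noteq> 1" and H: "det H = 1"
    and words: "\<And>i j k. matrix_power G i ** H ** matrix_power G j ** H ** matrix_power G k \<in> S"
  defines "D \<equiv> \<lambda>t. P ** unimodular_diag t ** Q"
  assumes s: "s \<noteq> 0" "t \<noteq> 0" "s' \<noteq> 0"
  shows "D s ** H ** D t ** H ** D s' \<in> zariski_closure_GL2 S"
proof -
  note torus = torus_in_zariski_closure[OF QP G l, where S = S]
  have "det P * det Q = 1" using arg_cong[OF QP, of det] by (simp add: det_mul mult.commute)
  then have "det G = 1" using l(1) by (simp add: G det_mul det_unimodular_diag)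
  then have "det (matrix_power G n) = 1" for n by (induction n) (simp_all add: det_mul)
  then have "matrix_power G i ** H ** matrix_power G j ** H ** matrix_power G k
      \<in> zariski_closure_GL2 S" for i j k
    using words by (intro subset_zariski_closure_GL2) (simp_all add: det_mul H)
  then have "D s ** H ** matrix_power G j ** H ** matrix_power G k \<in> zariski_closure_GL2 S" for j k
    using torus[of "mat 1" "H ** matrix_power G j ** H ** matrix_power G k" s] s(1)
    by (simp add: D_def matrix_mul_assoc)
  then have "D s ** H ** D t ** H ** matrix_power G k \<in> zariski_closure_GL2 S" for k
    using torus[of "D s ** H" "H ** matrix_power G k" t] s(2) by (simp add: D_def matrix_mul_assoc)
  then show ?thesis
    using torus[of "D s ** H ** D t ** H" "mat 1" s'] s(3) by (simp add: D_def matrix_mul_assoc)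
qed

lemma zariski_closure_contains_generic:
  fixes P Q :: cmat
  assumes QP: "Q ** P = mat 1" and G: "G = P ** unimodular_diag l ** Q"
    and l: "l \<noteq> 0" "norm l \<noteq> 1"
    and words: "\<And>i j k. matrix_power G i ** H ** matrix_power G j ** H ** matrix_power G k \<in> S"
    and H: "det H = 1" "\<And>i j. (Q ** H ** P)$i$j \<noteq> 0"
    and M: "det M = 1" "\<And>i j. (Q ** M ** P)$i$j \<noteq> 0"
  shows "M \<in> zariski_closure_GL2 S"
proof -
  have PQ: "P ** Q = mat 1" using QP by (simp only: matrix_left_right_inverse[of P])
  have det_conj: "det (Q ** A ** P) = det A" for A
    using arg_cong[OF QP, of det] by (simp add: det_mul mult.commute mult.left_commute)
  obtain s t s' where s: "s \<noteq> 0" "t \<noteq> 0" "s' \<noteq> 0"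
    and factors: "Q ** M ** P = unimodular_diag s ** (Q ** H ** P) ** unimodular_diag t **
      (Q ** H ** P) ** unimodular_diag s'"
    using diag_factorization[OF _ _ H(2) M(2)] H(1) M(1) by (metis det_conj)
  have "M = (P ** Q) ** M ** (P ** Q)" by (simp add: PQ)
  also have "\<dots> = P ** (Q ** M ** P) ** Q" by (simp add: matrix_mul_assoc)
  also have "\<dots> = (P ** unimodular_diag s ** Q) ** H ** (P ** unimodular_diag t ** Q) ** H **
      (P ** unimodular_diag s' ** Q)"
    unfolding factors by (simp add: matrix_mul_assoc)
  also have "\<dots> \<in> zariski_closure_GL2 S"
    by (rule torus_words_in_zariski_closure[OF QP G l H(1) words s])
  finally show ?thesis .
qed

section \<open>Groups generated by Schottky pairs are thin\<close>

definition displaces :: "'a::semiring_1^'n^'n \<Rightarrow> ('a^'n) set \<Rightarrow> bool" where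
  "displaces M U \<longleftrightarrow> (\<forall>v\<in>U. M *v v \<notin> U)"

lemma matrix_vector_mult_column: "A *v column j B = column j (A ** B)"
  for A :: "'a::semiring_1^'n^'m"
  by (simp add: vec_eq_iff column_def matrix_matrix_mult_def matrix_vector_mult_def)

lemma displaces_conjugate_nth_neq_0:
  fixes P Q M :: "'a::field^2^2"
  assumes QP: "Q ** P = mat 1" and M: "displaces M U" and U: "0 \<notin> U"
    "\<And>k v. k \<noteq> 0 \<Longrightarrow> k *s v \<in> U \<longleftrightarrow> v \<in> U" and col: "\<And>j. column j P \<in> U" and det: "det M \<noteq> 0"
  shows "(Q ** M ** P)$i$j \<noteq> 0"
proof
  assume zero: "(Q ** M ** P)$i$j = 0"
  have "P ** Q = mat 1" using QP by (simp only: matrix_left_right_inverse[of P])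
  then have "M ** P = P ** (Q ** M ** P)" by (simp add: matrix_mul_assoc)
  then have "M *v column j P = P *v column j (Q ** M ** P)"
    by (simp add: matrix_vector_mult_column)
  also have "\<dots> = (Q ** M ** P)$1$j *s column 1 P + (Q ** M ** P)$2$j *s column 2 P"
    by (simp add: matrix_mult_sum sum_2 column_def)
  finally obtain k i' where image: "M *v column j P = k *s column i' P"
    using zero exhaust_2[of i] by auto
  show False
  proof (cases "k = 0")
    case True
    then have "M *v column j P = 0" using image by simp
    then have "column j P = 0"
      using det by (metis invertible_det_nz invertible_left_inverse matrix_left_invertible_ker)
    then show False using U(1) col by metis
  next
    case False
    then have "M *v column j P \<in> U" using image U(2) col by simp
    then show False using M col by (auto simp: displaces_def)
  qed
qed

lemma norm_neq_1_if_add_inverse_gt_2: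
  fixes l :: complex and t :: real
  assumes t: "of_real t = l + 1 / l" "2 < \<bar>t\<bar>" and l: "l \<noteq> 0"
  shows "norm l \<noteq> 1"
proof
  assume norm_l: "norm l = 1"
  then have "l * cnj l = 1" using complex_norm_square[of l] by simp
  then have "1 / l = cnj l" using l by (simp add: field_simps)
  then have "complex_of_real t = of_real (2 * Re l)" using t(1) complex_add_cnj[of l] by simp
  then have "t = 2 * Re l" by (simp only: of_real_eq_iff)
  then show False using t(2) abs_Re_le_cmod[of l] norm_l by linarith
qed

lemma hyperbolic_diagonalization:
  fixes G :: cmat and t :: real
  assumes det: "det G = 1" and tr: "trace G = of_real t" "2 < \<bar>t\<bar>" and c: "G$2$1 \<noteq> 0"
  obtains P l where "l \<noteq> 0" "norm l \<noteq> 1" "det P \<noteq> 0" "G ** P = P ** unimodular_diag l"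
proof -
  obtain l :: complex where "1 * l\<^sup>2 + (- of_real t) * l + 1 = 0"
    using quadratic_root_exists[of 1 "- of_real t" 1] by auto
  then have l: "l\<^sup>2 = of_real t * l - 1" by (simp add: algebra_simps)
  then have l0: "l \<noteq> 0" by auto
  have t_eq: "of_real t = l + 1 / l" using l l0 by (simp add: field_simps power2_eq_square)
  have norm_l: "norm l \<noteq> 1" by (rule norm_neq_1_if_add_inverse_gt_2[OF t_eq tr(2) l0])
  define m where "m = 1 / l"
  have lm: "l * m = 1" using l0 by (simp add: m_def)
  define P where "P = mat22 (l - G$2$2) (m - G$2$2) (G$2$1) (G$2$1)"
  have "l \<noteq> m"
  proof
    assume "l = m"
    then have "(norm l)\<^sup>2 = 1" using lm by (metis norm_mult norm_one power2_eq_square)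
    then show False using norm_l by (simp add: abs_square_eq_1)
  qed
  then have "det P \<noteq> 0" using c by (simp add: P_def det_2 algebra_simps)
  moreover have "G ** P = P ** unimodular_diag l"
  proof -
    have a: "G$1$1 + G$2$2 = l + m" using tr(1) t_eq by (simp add: trace_2 m_def)
    have bc: "G$1$1 * G$2$2 - G$1$2 * G$2$1 = 1" using det by (simp add: det_2)
    have "G$1$1 * (l - G$2$2) + G$1$2 * G$2$1 = (l - G$2$2) * l" using a bc lm by algebra
    moreover have "G$1$1 * (m - G$2$2) + G$1$2 * G$2$1 = (m - G$2$2) * m" using a bc lm by algebra
    ultimately show ?thesis
      by (simp add: P_def mat2_eq_iff matrix_mult_nth_2 m_def algebra_simps)
  qed
  ultimately show ?thesis using that l0 norm_l by blast
qed

lemma eigenvector_in_ping_pong_domain: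
  assumes g: "ping_pong_generator r g" and v: "to_cplx g *v v = k *s v" "k \<noteq> 0" "v \<noteq> 0"
  shows "v \<in> ping_pong_domain r g"
proof (rule ccontr)
  assume "v \<notin> ping_pong_domain r g"
  moreover have "g \<in> cyclic_group g" "g \<noteq> mat 1"
    using g self_in_cyclic_group by (auto simp: ping_pong_generator_def trace_2)
  ultimately have "k *s v \<in> ping_pong_domain r g"
    using pushes_intoD[OF cyclic_group_pushes_into[OF g]] v by metis
  then show False using \<open>v \<notin> _\<close> v(2) by simp
qed

lemma schottky_pair_displaces:
  assumes gh: "schottky_pair r g h"
  shows "displaces (to_cplx h) (ping_pong_domain r g)"
  unfolding displaces_def
proof
  fix v
  assume v: "v \<in> ping_pong_domain r g"
  then have "v \<noteq> 0" "v \<notin> ping_pong_domain r h" using gh by (auto simp: schottky_pair_def)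
  moreover have "h \<in> cyclic_group h" "h \<noteq> mat 1"
    using gh self_in_cyclic_group by (auto simp: schottky_pair_def ping_pong_generator_def trace_2)
  ultimately have "to_cplx h *v v \<in> ping_pong_domain r h"
    using gh by (intro pushes_intoD[OF cyclic_group_pushes_into]) (auto simp: schottky_pair_def)
  then show "to_cplx h *v v \<notin> ping_pong_domain r g" using gh by (auto simp: schottky_pair_def)
qed

lemma matrix_power_in_gen_group: "g \<in> gen_group S \<Longrightarrow> matrix_power g n \<in> gen_group S"
  by (induction n) (auto intro: gen_group.intros)

lemma schottky_pair_zariski_closure:
  assumes gh: "schottky_pair r g h" and M: "det M = 1" "displaces M (ping_pong_domain r g)"
  shows "M \<in> zariski_closure_GL2 (to_cplx ` Gamma (g, h))"
proof -
  have g: "ping_pong_generator r g" "g \<in> SL2Z" "2 < \<bar>trace g\<bar>" "g$2$1 \<noteq> 0" and h: "h \<in> SL2Z"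
    using gh by (auto simp: schottky_pair_def ping_pong_generator_def)
  have det: "det (to_cplx g) = 1" "det (to_cplx h) = 1"
    using g(2) h by (simp_all add: det_to_cplx SL2Z_def)
  obtain P l where l: "l \<noteq> 0" "norm l \<noteq> 1" and P: "det P \<noteq> 0"
    and conj: "to_cplx g ** P = P ** unimodular_diag l"
    by (rule hyperbolic_diagonalization[OF det(1), of "of_int (trace g)"])
      (use g in \<open>auto simp: trace_2\<close>)
  obtain Q where QP: "Q ** P = mat 1" "P ** Q = mat 1"
    using P unfolding invertible_det_nz[symmetric] invertible_def by blast
  have G: "to_cplx g = P ** unimodular_diag l ** Q"
    using QP(2) conj by (metis matrix_mul_assoc matrix_mul_rid)
  have column: "column j P \<in> ping_pong_domain r g" for j
  proof (rule eigenvector_in_ping_pong_domain[OF g(1)])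
    have "to_cplx g *v column j P = column j (P ** unimodular_diag l)"
      by (simp add: matrix_vector_mult_column conj)
    also have "\<dots> = unimodular_diag l $ j $ j *s column j P"
      using exhaust_2[of j] by (auto simp: column_def vec_eq_iff matrix_mult_nth_2)
    finally show "to_cplx g *v column j P = unimodular_diag l $ j $ j *s column j P" .
    show "unimodular_diag l $ j $ j \<noteq> 0" using exhaust_2[of j] l(1) by auto
    show "column j P \<noteq> 0"
      using exhaust_2[of j] P by (auto simp: column_def vec_eq_iff forall_2 det_2)
  qed
  have generic: "(Q ** A ** P)$i$j \<noteq> 0"
    if "det A = 1" "displaces A (ping_pong_domain r g)" for A i j
    by (rule displaces_conjugate_nth_neq_0[OF QP(1) that(2)]) (simp_all add: column that(1))
  show ?thesis
  proof (rule zariski_closure_contains_generic[OF QP(1) G l])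
    fix i j k
    have "g \<in> Gamma (g, h)" "h \<in> Gamma (g, h)" by (auto simp: Gamma_def intro: gen_group.gen_base)
    then have "matrix_power g i ** h ** matrix_power g j ** h ** matrix_power g k \<in> Gamma (g, h)"
      unfolding Gamma_def by (intro gen_group.gen_mult matrix_power_in_gen_group)
    then show "matrix_power (to_cplx g) i ** to_cplx h ** matrix_power (to_cplx g) j ** to_cplx h **
        matrix_power (to_cplx g) k \<in> to_cplx ` Gamma (g, h)"
      by (auto simp: to_cplx_mult to_cplx_matrix_power intro!: rev_image_eqI)
  qed (use generic det M schottky_pair_displaces[OF gh] in auto)
qed

definition translation :: "int \<Rightarrow> imat" where
  "translation k = mat22 1 k 0 1"

lemma translation_mult: "translation j ** translation k = translation (j + k)"
  by (simp add: translation_def mat2_eq_iff matrix_mult_nth_2)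

lemma translation_eq_1_iff: "translation k = mat 1 \<longleftrightarrow> k = 0"
  by (simp add: translation_def mat2_eq_iff)

lemma translation_slope_ball:
  "v \<in> slope_ball r x \<Longrightarrow> to_cplx (translation k) *v v \<in> slope_ball r (x + of_int k)"
  by (simp add: slope_ball_def translation_def matrix_vector_mult_nth_2 algebra_simps)

lemma translation_displaces:
  assumes "2 * (r + \<bar>image_of_infinity g\<bar> + \<bar>image_of_infinity (sl2_inv g)\<bar>) < of_int k"
  shows "displaces (to_cplx (translation k)) (ping_pong_domain r g)"
proof -
  have "slope_ball r (x + of_int k) \<inter> slope_ball r y = {}"
    if "x \<in> {image_of_infinity g, image_of_infinity (sl2_inv g)}"
      "y \<in> {image_of_infinity g, image_of_infinity (sl2_inv g)}" for x y
    using that assms by (intro disjoint_slope_balls) auto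
  then show ?thesis
    using translation_slope_ball[of _ r _ k] unfolding displaces_def ping_pong_domain_def by blast
qed

lemma schottky_pair_translation_cosets:
  assumes gh: "schottky_pair r g h"
  shows "inj (\<lambda>k. (\<lambda>x. translation k ** x) ` Gamma (g, h))"
proof (rule injI)
  fix j k
  assume "(\<lambda>x. translation j ** x) ` Gamma (g, h) = (\<lambda>x. translation k ** x) ` Gamma (g, h)"
  moreover have "mat 1 \<in> Gamma (g, h)" by (simp add: Gamma_def gen_group.gen_one)
  ultimately have "translation j ** mat 1 \<in> (\<lambda>x. translation k ** x) ` Gamma (g, h)" by blast
  then obtain x where x: "x \<in> Gamma (g, h)" "translation j = translation k ** x" by auto
  have "translation 0 = mat 1" by (simp add: translation_eq_1_iff)
  then have "x = translation (- k) ** (translation k ** x)"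
    by (simp add: matrix_mul_assoc translation_mult)
  also have "\<dots> = translation (j - k)" by (simp add: x(2)[symmetric] translation_mult)
  finally have "x = translation (j - k)" .
  then have "translation (j - k) = mat 1"
    using schottky_pair_stabilizer_of_infinity[OF gh x(1)] by (simp add: translation_def)
  then show "j = k" by (simp add: translation_eq_1_iff)
qed

lemma schottky_pair_thin:
  assumes gh: "schottky_pair r g h"
  shows "thin (Gamma (g, h))"
proof -
  define H where "H = {A \<in> GL2Z. to_cplx A \<in> zariski_closure_GL2 (to_cplx ` Gamma (g, h))}"
  define coset where "coset A = (\<lambda>x. A ** x) ` Gamma (g, h)" for A :: imat
  obtain K where K: "2 * (r + \<bar>image_of_infinity g\<bar> + \<bar>image_of_infinity (sl2_inv g)\<bar>) < of_int K"
    using ex_less_of_int by blast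
  have "translation k \<in> H" if "k \<ge> K" for k
  proof -
    have "displaces (to_cplx (translation k)) (ping_pong_domain r g)"
      using K that by (intro translation_displaces) linarith
    then show ?thesis
      using schottky_pair_zariski_closure[OF gh]
      by (simp add: H_def GL2Z_def det_to_cplx translation_def det_2)
  qed
  then have "(\<lambda>k. coset (translation k)) ` {K..} \<subseteq> {coset A |A. A \<in> H}" by auto
  moreover have "inj_on (\<lambda>k. coset (translation k)) {K..}"
    unfolding coset_def by (rule inj_on_subset[OF schottky_pair_translation_cosets[OF gh]]) simp
  then have "infinite ((\<lambda>k. coset (translation k)) ` {K..})"
    using finite_imageD infinite_Ici by blast
  ultimately have "infinite {coset A |A. A \<in> H}" using finite_subset by blast
  then show ?thesis unfolding thin_def Let_def H_def[symmetric] coset_def .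
qed

section \<open>Divisors and congruences\<close>

lemma card_eq_sum_fibres:
  assumes "finite A" "finite B" "f ` A \<subseteq> B"
  shows "card A = (\<Sum>b\<in>B. card {a\<in>A. f a = b})"
  using sum.group[OF assms, of "\<lambda>_. 1::nat"] by simp

lemma card_le_card_times_fibre:
  fixes k :: real
  assumes "finite A" "finite B" "f ` A \<subseteq> B" and k: "\<And>b. b \<in> B \<Longrightarrow> real (card {a\<in>A. f a = b}) \<le> k"
  shows "real (card A) \<le> real (card B) * k"
proof -
  have "real (card A) = (\<Sum>b\<in>B. real (card {a\<in>A. f a = b}))"
    by (simp add: card_eq_sum_fibres[OF assms(1-3)])
  also have "\<dots> \<le> real (card B) * k" by (rule sum_bounded_above[OF k])
  finally show ?thesis .
qed

lemma card_Int_real_interval_le: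
  fixes x y :: real
  assumes "x \<le> y"
  shows "real (card {k::int. x \<le> of_int k \<and> of_int k \<le> y}) \<le> y - x + 1"
    and "finite {k::int. x \<le> of_int k \<and> of_int k \<le> y}"
proof -
  have interval: "{k::int. x \<le> of_int k \<and> of_int k \<le> y} = {\<lceil>x\<rceil>..\<lfloor>y\<rfloor>}"
    by (auto simp: le_floor_iff ceiling_le_iff)
  show "real (card {k::int. x \<le> of_int k \<and> of_int k \<le> y}) \<le> y - x + 1"
    unfolding interval card_atLeastAtMost_int using assms by linarith
  show "finite {k::int. x \<le> of_int k \<and> of_int k \<le> y}" unfolding interval by simp
qed

lemma card_congruent_le:
  fixes S :: "int set" and q x y :: int
  assumes S: "S \<subseteq> {x..y}" "x \<le> y" and q: "q \<noteq> 0"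
    and cong: "\<And>u v. u \<in> S \<Longrightarrow> v \<in> S \<Longrightarrow> q dvd u - v"
  shows "real (card S) \<le> of_int (y - x) / \<bar>of_int q\<bar> + 1"
proof (cases "S = {}")
  case False
  then obtain z where z: "z \<in> S" by blast
  let ?I = "{k::int. (x - z) / \<bar>of_int q\<bar> \<le> real_of_int k \<and> k \<le> (y - z) / \<bar>of_int q\<bar>}"
  have le: "(x - z) / \<bar>real_of_int q\<bar> \<le> (y - z) / \<bar>real_of_int q\<bar>"
    using S(2) by (intro divide_right_mono) auto
  have "S \<subseteq> (\<lambda>k. z + \<bar>q\<bar> * k) ` ?I"
  proof
    fix u
    assume u: "u \<in> S"
    then obtain k where "u - z = \<bar>q\<bar> * k" using cong[OF u z] by (metis abs_dvd_iff dvdE)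
    then have k: "u = z + \<bar>q\<bar> * k" by simp
    moreover have "real_of_int (x - z) \<le> \<bar>real_of_int q\<bar> * k"
      "\<bar>real_of_int q\<bar> * k \<le> real_of_int (y - z)"
      using u S(1) k by (auto simp flip: of_int_abs of_int_mult)
    then have "k \<in> ?I" using q by (simp add: divide_le_eq le_divide_eq mult.commute)
    ultimately show "u \<in> (\<lambda>k. z + \<bar>q\<bar> * k) ` ?I" by blast
  qed
  then have "card S \<le> card ?I" by (rule surj_card_le[OF card_Int_real_interval_le(2)[OF le]])
  then have "real (card S) \<le> (y - z) / \<bar>real_of_int q\<bar> - (x - z) / \<bar>real_of_int q\<bar> + 1"
    using card_Int_real_interval_le(1)[OF le] by linarith
  then show ?thesis by (simp add: diff_divide_distrib)
qed (use S(2) in simp)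

lemma mult3_dvd_mult_gcds:
  fixes x y z n :: int
  assumes "x dvd n" "y dvd n" "z dvd n"
  shows "x * y * z dvd n * (gcd x y * gcd x z * gcd y z)"
proof -
  define L where "L = lcm x y"
  have "gcd (x * y) z dvd gcd (y * x) (y * z)" by (simp add: mult.commute[of y x] dvd_mult)
  also have "\<dots> = \<bar>y * gcd x z\<bar>" by (simp add: abs_mult gcd_mult_distrib_int)
  finally have "gcd (x * y) z dvd gcd (gcd x z * y) (gcd x z * z)"
    by (intro gcd_greatest) (simp_all add: mult.commute)
  also have "\<dots> = gcd x z * gcd y z" by (simp flip: gcd_mult_distrib_int)
  finally have "gcd (x * y) z dvd gcd x z * gcd y z" .
  moreover have "gcd L z dvd gcd (x * y) z" by (intro gcd_mono) (simp_all add: L_def)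
  ultimately have "gcd L z dvd gcd x z * gcd y z" by (rule dvd_trans[rotated])
  moreover have "lcm L z dvd n" using assms by (simp add: L_def)
  ultimately have "gcd x y * (gcd L z * lcm L z) dvd gcd x y * (gcd x z * gcd y z * n)"
    by (intro mult_dvd_mono dvd_refl)
  moreover have "\<bar>x * y * z\<bar> = gcd x y * (gcd L z * lcm L z)"
    by (simp add: L_def abs_mult mult.assoc[symmetric])
  ultimately have "\<bar>x * y * z\<bar> dvd gcd x y * (gcd x z * gcd y z * n)" by simp
  then show ?thesis by (simp only: abs_dvd_iff mult_ac)
qed

lemma gcd_le_if_div_eq:
  fixes c d m :: int
  assumes m: "m > 0" and "c div m = d div m" "c \<noteq> d"
  shows "gcd c d \<le> m"
proof -
  have "gcd c d dvd c - d" by simp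
  then have "gcd c d \<le> \<bar>c - d\<bar>" using \<open>c \<noteq> d\<close> by (intro zdvd_imp_le) auto
  also have "c - d = c mod m - d mod m"
    using \<open>c div m = d div m\<close> by (simp add: minus_div_mult_eq_mod[symmetric])
  also have "\<bar>\<dots>\<bar> \<le> m"
    using pos_mod_bound[OF m, of c] pos_mod_bound[OF m, of d] pos_mod_sign[OF m, of c]
      pos_mod_sign[OF m, of d] by linarith
  finally show ?thesis .
qed

lemma card_large_divisors_in_block_le:
  fixes n m K b :: int
  assumes n: "n \<noteq> 0" and m: "m > 0" "m ^ 3 * \<bar>n\<bar> < K ^ 3" and K: "K \<ge> 0"
  shows "card {c. c dvd n \<and> K \<le> \<bar>c\<bar> \<and> c div m = b} \<le> 2"
proof (rule ccontr)
  assume "\<not> card {c. c dvd n \<and> K \<le> \<bar>c\<bar> \<and> c div m = b} \<le> 2"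
  then have "3 \<le> card {c. c dvd n \<and> K \<le> \<bar>c\<bar> \<and> c div m = b}" by simp
  then obtain T where T: "T \<subseteq> {c. c dvd n \<and> K \<le> \<bar>c\<bar> \<and> c div m = b}" "card T = 3"
    by (elim obtain_subset_with_card_n) (rule that)
  then obtain x y z where xyz: "T = {x, y, z}" "x \<noteq> y" "x \<noteq> z" "y \<noteq> z"
    by (auto simp: card_3_iff)
  have gcds: "gcd x y * gcd x z * gcd y z \<le> m * m * m"
    using xyz T(1) m(1) by (intro mult_mono gcd_le_if_div_eq) auto
  have "K ^ 3 \<le> \<bar>x\<bar> * \<bar>y\<bar> * \<bar>z\<bar>"
    using xyz T(1) K unfolding power3_eq_cube by (intro mult_mono) auto
  also have "\<dots> \<le> \<bar>n * (gcd x y * gcd x z * gcd y z)\<bar>"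
  proof -
    have "x * y * z dvd n * (gcd x y * gcd x z * gcd y z)"
      using xyz T(1) by (intro mult3_dvd_mult_gcds) auto
    moreover have "n * (gcd x y * gcd x z * gcd y z) \<noteq> 0" using n xyz by auto
    ultimately show ?thesis using dvd_imp_le_int by (metis abs_mult)
  qed
  also have "\<dots> \<le> \<bar>n\<bar> * m ^ 3"
    unfolding abs_mult power3_eq_cube using gcds by (intro mult_left_mono) auto
  finally show False using m(2) by (simp add: mult.commute)
qed

lemma card_large_divisors_le:
  fixes n :: int and L K N :: nat
  assumes n: "n \<noteq> 0" and L: "L > 0" "int L ^ 3 * \<bar>n\<bar> < int K ^ 3"
  shows "card {c. c dvd n \<and> int K \<le> \<bar>c\<bar> \<and> \<bar>c\<bar> \<le> int N} \<le> 4 * (N div L + 1)"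
proof -
  define S where "S = {c. c dvd n \<and> int K \<le> \<bar>c\<bar> \<and> \<bar>c\<bar> \<le> int N}"
  define B where "B = {- int (N div L) - 1..int (N div L)}"
  have fin: "finite S" by (rule finite_subset[of _ "{- int N..int N}"]) (auto simp: S_def)
  have "(\<lambda>c. c div int L) ` S \<subseteq> B"
  proof (rule image_subsetI)
    fix c
    assume "c \<in> S"
    then have c: "- int N \<le> c" "c \<le> int N" by (auto simp: S_def)
    have "c div int L \<le> int N div int L" using c(2) L(1) by (intro zdiv_mono1) auto
    moreover have "(- int N) div int L \<le> c div int L" using c(1) L(1) by (intro zdiv_mono1) auto
    moreover have "- (int N div int L) - 1 \<le> (- int N) div int L"
      using L(1) by (simp add: zdiv_zminus1_eq_if)
    ultimately show "c div int L \<in> B" by (simp add: B_def zdiv_int)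
  qed
  then have "card S = (\<Sum>b\<in>B. card {c\<in>S. c div int L = b})"
    by (intro card_eq_sum_fibres fin) (simp add: B_def)
  also have "\<dots> \<le> (\<Sum>b\<in>B. 2)"
  proof (rule sum_mono)
    fix b
    have "finite {c. c dvd n \<and> int K \<le> \<bar>c\<bar> \<and> c div int L = b}"
      by (rule finite_subset[OF _ finite_divisors_int[OF n]]) auto
    then have "card {c\<in>S. c div int L = b} \<le> card {c. c dvd n \<and> int K \<le> \<bar>c\<bar> \<and> c div int L = b}"
      by (intro card_mono) (auto simp: S_def)
    also have "\<dots> \<le> 2" using L by (intro card_large_divisors_in_block_le n) auto
    finally show "card {c\<in>S. c div int L = b} \<le> 2" .
  qed
  finally show ?thesis by (simp add: S_def B_def nat_add_distrib algebra_simps)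
qed

section \<open>Counting integer matrices with bounded entries\<close>

definition sl2_box :: "nat \<Rightarrow> imat set" where
  "sl2_box N = {g \<in> SL2Z. \<forall>i j. \<bar>g$i$j\<bar> \<le> int N}"

lemma sl2_box_nth: "g \<in> sl2_box N \<Longrightarrow> g$i$j \<in> {- int N..int N}"
  by (simp add: sl2_box_def abs_le_iff minus_le_iff)

lemma sl2_inv_in_sl2_box [simp]: "sl2_inv g \<in> sl2_box N \<longleftrightarrow> g \<in> sl2_box N"
  by (auto simp: sl2_box_def forall_2)

lemma transpose_in_sl2_box [simp]: "transpose g \<in> sl2_box N \<longleftrightarrow> g \<in> sl2_box N"
  by (auto simp: sl2_box_def SL2Z_def transpose_def det_transpose[unfolded transpose_def])

lemma finite_sl2_box [simp]: "finite (sl2_box N)"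
proof (rule inj_on_finite[where f = "\<lambda>g. (g$1$1, g$1$2, g$2$1, g$2$2)"])
  let ?I = "{- int N..int N}"
  show "inj_on (\<lambda>g. (g$1$1, g$1$2, g$2$1, g$2$2)) (sl2_box N)"
    by (auto simp: inj_on_def mat2_eq_iff)
  show "(\<lambda>g. (g$1$1, g$1$2, g$2$1, g$2$2)) ` sl2_box N \<subseteq> ?I \<times> ?I \<times> ?I \<times> ?I"
    by (intro image_subsetI SigmaI sl2_box_nth)
qed simp

lemma SL2Z_eq_column:
  assumes g: "g \<in> SL2Z" "h \<in> SL2Z" and column: "column 1 g = column 1 h"
  shows "g$i$2 - h$i$2 = (h$2$2 * g$1$2 - h$1$2 * g$2$2) * g$i$1"
proof -
  have "h$1$1 = g$1$1" "h$2$1 = g$2$1" using column by (auto simp: column_def vec_eq_iff)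
  then have det: "g$1$1 * g$2$2 - g$1$2 * g$2$1 = 1" "g$1$1 * h$2$2 - h$1$2 * g$2$1 = 1"
    using g by (simp_all add: SL2Z_iff)
  then have "g$1$2 - h$1$2 = (h$2$2 * g$1$2 - h$1$2 * g$2$2) * g$1$1" by algebra
  moreover have "g$2$2 - h$2$2 = (h$2$2 * g$1$2 - h$1$2 * g$2$2) * g$2$1" using det by algebra
  ultimately show ?thesis using exhaust_2[of i] by auto
qed

lemma card_fixed_column_le:
  assumes F: "F \<subseteq> sl2_box N" "\<And>g. g \<in> F \<Longrightarrow> column 1 g = u" and u: "u$i \<noteq> 0"
  shows "real (card F) \<le> 2 * real N / \<bar>of_int (u$i)\<bar> + 1"
proof -
  have first: "g$j$1 = u$j" if "g \<in> F" for g j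
    using F(2)[OF that] by (auto simp: column_def)
  have diff: "g$j$2 - h$j$2 = (h$2$2 * g$1$2 - h$1$2 * g$2$2) * u$j" if "g \<in> F" "h \<in> F" for g h j
    using SL2Z_eq_column[of g h j] that F first by (auto simp: sl2_box_def)
  have "inj_on (\<lambda>g. g$i$2) F"
  proof (rule inj_onI)
    fix g h
    assume gh: "g \<in> F" "h \<in> F" "g$i$2 = h$i$2"
    then have "h$2$2 * g$1$2 - h$1$2 * g$2$2 = 0" using diff[OF gh(1,2), of i] u by simp
    then have "g$j$2 = h$j$2" for j using diff[OF gh(1,2), of j] by simp
    then show "g = h" using first[OF gh(1)] first[OF gh(2)] by (simp add: mat2_eq_iff)
  qed
  then have "card F = card ((\<lambda>g. g$i$2) ` F)" by (simp add: card_image)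
  also have "real \<dots> \<le> of_int (int N - - int N) / \<bar>of_int (u$i)\<bar> + 1"
  proof (rule card_congruent_le[OF _ _ u])
    show "(\<lambda>g. g$i$2) ` F \<subseteq> {- int N..int N}"
      using F(1) by (intro image_subsetI sl2_box_nth) auto
    show "u$i dvd x - y" if "x \<in> (\<lambda>g. g$i$2) ` F" "y \<in> (\<lambda>g. g$i$2) ` F" for x y
      using that diff by auto
  qed simp
  finally show ?thesis by simp
qed

lemma sum_inverse_abs_int: "(\<Sum>a\<in>{- int N..int N} - {0}. 1 / \<bar>real_of_int a\<bar>) = 2 * harm N"
proof -
  have split: "{- int N..int N} - {0} = int ` {1..N} \<union> (\<lambda>k. - int k) ` {1..N}"
  proof (intro equalityI subsetI)
    fix x
    assume "x \<in> {- int N..int N} - {0}"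
    then have "x = int (nat x) \<and> nat x \<in> {1..N} \<or> x = - int (nat (- x)) \<and> nat (- x) \<in> {1..N}"
      by auto
    then show "x \<in> int ` {1..N} \<union> (\<lambda>k. - int k) ` {1..N}" by blast
  qed auto
  have "(\<Sum>a\<in>{- int N..int N} - {0}. 1 / \<bar>real_of_int a\<bar>)
      = (\<Sum>a\<in>int ` {1..N}. 1 / \<bar>real_of_int a\<bar>) + (\<Sum>a\<in>(\<lambda>k. - int k) ` {1..N}. 1 / \<bar>real_of_int a\<bar>)"
    unfolding split by (rule sum.union_disjoint) auto
  also have "\<dots> = harm N + harm N"
    by (simp add: sum.reindex inj_on_def harm_def inverse_eq_divide)
  finally show ?thesis by simp
qed

lemma one_le_harm: "1 \<le> n \<Longrightarrow> 1 \<le> (harm n :: real)"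
  using harm_mono[of 1 n, where 'a = real] by (simp add: harm_def)

lemma card_upper_left_zero_le:
  assumes N: "N \<ge> 1"
  shows "real (card {g\<in>sl2_box N. g$1$1 = 0}) \<le> 6 * real N"
proof -
  define A where "A = {g\<in>sl2_box N. g$1$1 = 0}"
  have "g$2$1 \<in> {1, - 1}" if "g \<in> A" for g
  proof -
    have "g$1$2 * (- g$2$1) = 1" using that by (auto simp: A_def sl2_box_def SL2Z_iff)
    then show ?thesis unfolding zmult_eq_1_iff by auto
  qed
  then have "(\<lambda>g. g$2$1) ` A \<subseteq> {1, - 1}" by blast
  then have "real (card A) \<le> real (card {1, - 1 :: int}) * (3 * real N)"
  proof (rule card_le_card_times_fibre[rotated 2])
    fix c :: int
    assume c: "c \<in> {1, - 1}"
    have "real (card {g\<in>A. g$2$1 = c}) \<le> 2 * real N / \<bar>of_int (vector [0, c] $ (2::2))\<bar> + 1"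
      using c by (intro card_fixed_column_le) (auto simp: A_def column_def vec_eq_iff forall_2)
    then show "real (card {g\<in>A. g$2$1 = c}) \<le> 3 * real N" using c N by auto
  qed (simp_all add: A_def)
  then show ?thesis by (simp add: A_def)
qed

lemma card_upper_left_nonzero_le:
  "real (card {g\<in>sl2_box N. g$1$1 \<noteq> 0 \<and> \<bar>g$2$1\<bar> \<le> int M}) \<le> 6 * real N * (2 * real M + 1) * harm N"
proof -
  define A where "A = {g\<in>sl2_box N. g$1$1 \<noteq> 0 \<and> \<bar>g$2$1\<bar> \<le> int M}"
  define B where "B = ({- int N..int N} - {0}) \<times> {- int M..int M}"
  have image: "(\<lambda>g. (g$1$1, g$2$1)) ` A \<subseteq> B"
    unfolding A_def B_def using sl2_box_nth by (fastforce simp: abs_le_iff)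
  have "real (card A) = (\<Sum>ac\<in>B. real (card {g\<in>A. (g$1$1, g$2$1) = ac}))"
    by (subst card_eq_sum_fibres[OF _ _ image]) (simp_all add: A_def B_def)
  also have "\<dots> \<le> (\<Sum>(a, c)\<in>B. 3 * real N * (1 / \<bar>of_int a\<bar>))"
  proof (rule sum_mono)
    fix ac
    assume "ac \<in> B"
    then obtain a c where ac: "ac = (a, c)" "a \<noteq> 0" "\<bar>a\<bar> \<le> int N"
      by (cases ac) (auto simp: B_def abs_le_iff)
    have "real (card {g\<in>A. (g$1$1, g$2$1) = ac})
        \<le> 2 * real N / \<bar>of_int (vector [a, c] $ (1::2))\<bar> + 1"
      using ac by (intro card_fixed_column_le) (auto simp: A_def column_def vec_eq_iff forall_2)
    then have "real (card {g\<in>A. (g$1$1, g$2$1) = ac}) \<le> 2 * real N / \<bar>of_int a\<bar> + 1" by simp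
    also have "1 \<le> real N / \<bar>of_int a\<bar>" using ac by (simp add: field_simps)
    finally show "real (card {g\<in>A. (g$1$1, g$2$1) = ac})
        \<le> (case ac of (a, c) \<Rightarrow> 3 * real N * (1 / \<bar>of_int a\<bar>))"
      using ac by simp
  qed
  also have "\<dots> = (2 * real M + 1) * (3 * real N) * (\<Sum>a\<in>{- int N..int N} - {0}. 1 / \<bar>of_int a\<bar>)"
    by (simp add: B_def sum_distrib_left flip: sum.cartesian_product)
  also have "\<dots> = 6 * real N * (2 * real M + 1) * harm N" by (simp add: sum_inverse_abs_int)
  finally show ?thesis by (simp add: A_def)
qed

lemma card_lower_left_le:
  assumes N: "N \<ge> 1"
  shows "real (card {g\<in>sl2_box N. \<bar>g$2$1\<bar> \<le> int M}) \<le> 12 * real N * (2 * real M + 1) * harm N"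
proof -
  have "{g\<in>sl2_box N. \<bar>g$2$1\<bar> \<le> int M}
      \<subseteq> {g\<in>sl2_box N. g$1$1 = 0} \<union> {g\<in>sl2_box N. g$1$1 \<noteq> 0 \<and> \<bar>g$2$1\<bar> \<le> int M}"
    by blast
  then have "card {g\<in>sl2_box N. \<bar>g$2$1\<bar> \<le> int M}
      \<le> card {g\<in>sl2_box N. g$1$1 = 0} + card {g\<in>sl2_box N. g$1$1 \<noteq> 0 \<and> \<bar>g$2$1\<bar> \<le> int M}"
    by (intro order.trans[OF card_mono card_Un_le]) auto
  then have "real (card {g\<in>sl2_box N. \<bar>g$2$1\<bar> \<le> int M})
      \<le> 6 * real N * (1 * 1) + 6 * real N * (2 * real M + 1) * harm N"
    using card_upper_left_zero_le[OF N] card_upper_left_nonzero_le[of N M] by linarith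
  also have "\<dots> \<le> 6 * real N * ((2 * real M + 1) * harm N) + 6 * real N * (2 * real M + 1) * harm N"
    using one_le_harm[OF N] by (intro add_mono mult_left_mono mult_mono) auto
  finally show ?thesis by (simp add: algebra_simps)
qed

lemma card_upper_right_zero_le:
  assumes N: "N \<ge> 1"
  shows "real (card {g\<in>sl2_box N. g$1$2 = 0}) \<le> 12 * real N * harm N"
proof -
  have transpose_nth: "transpose g $ i $ j = g $ j $ i" for g :: imat and i j
    by (simp add: transpose_def)
  have "bij_betw transpose {g\<in>sl2_box N. g$1$2 = 0} {g\<in>sl2_box N. \<bar>g$2$1\<bar> \<le> int 0}"
    by (rule bij_betw_byWitness[where f' = transpose]) (auto simp: transpose_nth)
  then show ?thesis using card_lower_left_le[OF N, of 0] by (simp add: bij_betw_same_card)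
qed

lemma card_fixed_diagonal_le:
  assumes F: "F \<subseteq> sl2_box N"
    "\<And>g. g \<in> F \<Longrightarrow> int K \<le> \<bar>g$2$1\<bar> \<and> g$1$2 \<noteq> 0 \<and> g$1$1 = a \<and> g$2$2 = d"
    and L: "L > 0" "int L ^ 3 * \<bar>a * d - 1\<bar> < int K ^ 3"
  shows "card F \<le> 4 * (N div L + 1)"
proof -
  define C where "C = {c. c dvd a * d - 1 \<and> int K \<le> \<bar>c\<bar> \<and> \<bar>c\<bar> \<le> int N}"
  have "0 < int K ^ 3" using L(2) by (rule le_less_trans[rotated]) simp
  then have K: "K > 0" by simp
  have entries: "g$2$1 \<in> C" "g$2$1 \<noteq> 0" "g$1$2 \<noteq> 0" "a * d - 1 = g$1$2 * g$2$1"
      "g$1$1 = a" "g$2$2 = d"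
    if "g \<in> F" for g
    using F(1) F(2)[OF that] that K by (auto simp: C_def sl2_box_def SL2Z_iff algebra_simps)
  have "inj_on (\<lambda>g. g$2$1) F"
  proof (rule inj_onI)
    fix g h
    assume gh: "g \<in> F" "h \<in> F" "g$2$1 = h$2$1"
    then have "g$1$2 = h$1$2" using entries(2,4)[OF gh(1)] entries(4)[OF gh(2)] by simp
    then show "g = h"
      using entries(5,6)[OF gh(1)] entries(5,6)[OF gh(2)] gh(3) by (simp add: mat2_eq_iff)
  qed
  moreover have "finite C" by (rule finite_subset[of _ "{- int N..int N}"]) (auto simp: C_def)
  ultimately have "card F \<le> card C" using entries(1) by (intro card_inj_on_le) auto
  moreover have "card C \<le> 4 * (N div L + 1)" if "F \<noteq> {}"
  proof -
    obtain g where "g \<in> F" using \<open>F \<noteq> {}\<close> by blast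
    then have "a * d - 1 \<noteq> 0" using entries(2-4)[of g] by simp
    then show ?thesis unfolding C_def using L by (rule card_large_divisors_le)
  qed
  ultimately show ?thesis by (cases "F = {}") auto
qed

lemma card_small_trace_le:
  assumes L: "L > 0" "L ^ 3 * (N + 1)\<^sup>2 < K ^ 3"
  shows "card {g\<in>sl2_box N. int K \<le> \<bar>g$2$1\<bar> \<and> g$1$2 \<noteq> 0 \<and> \<bar>trace g\<bar> \<le> 2}
    \<le> 20 * (2 * N + 1) * (N div L + 1)"
proof -
  define A where "A = {g\<in>sl2_box N. int K \<le> \<bar>g$2$1\<bar> \<and> g$1$2 \<noteq> 0 \<and> \<bar>trace g\<bar> \<le> 2}"
  define B where "B = {- 2..2::int} \<times> {- int N..int N}"
  have fibre: "card {g\<in>A. (trace g, g$1$1) = (t, a)} \<le> 4 * (N div L + 1)"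
    if ta: "(t, a) \<in> B" for t a
  proof -
    have "\<bar>a * (t - a)\<bar> \<le> int N * (int N + 2)"
      unfolding abs_mult using ta by (intro mult_mono) (auto simp: B_def)
    then have "\<bar>a * (t - a) - 1\<bar> \<le> int ((N + 1)\<^sup>2)" by (simp add: power2_eq_square algebra_simps)
    then have "int L ^ 3 * \<bar>a * (t - a) - 1\<bar> \<le> int (L ^ 3 * (N + 1)\<^sup>2)"
      by (simp add: mult_left_mono)
    also have "\<dots> < int (K ^ 3)" using L(2) by (simp only: of_nat_less_iff)
    finally have small: "int L ^ 3 * \<bar>a * (t - a) - 1\<bar> < int K ^ 3" by simp
    show ?thesis
      by (rule card_fixed_diagonal_le[OF _ _ L(1) small]) (auto simp: A_def trace_2)
  qed
  have "card A = (\<Sum>ta\<in>B. card {g\<in>A. (trace g, g$1$1) = ta})"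
    by (rule card_eq_sum_fibres) (auto simp: A_def B_def dest: sl2_box_nth[of _ N 1 1])
  also have "\<dots> \<le> (\<Sum>ta\<in>B. 4 * (N div L + 1))" using fibre by (intro sum_mono) auto
  also have "\<dots> = 20 * (2 * N + 1) * (N div L + 1)"
    by (simp add: B_def nat_add_distrib nat_mult_distrib algebra_simps)
  finally show ?thesis by (simp add: A_def)
qed

lemma card_near_line_le:
  fixes \<theta> \<delta> :: real and N :: nat
  assumes \<delta>: "\<delta> \<ge> 0"
  defines "S \<equiv> SIGMA c:{- int N..int N}. {a::int. \<bar>of_int a - of_int c * \<theta>\<bar> \<le> \<delta>}"
  shows "finite S" and "real (card S) \<le> (2 * real N + 1) * (2 * \<delta> + 1)"
proof -
  define I where "I c = {a::int. \<bar>of_int a - of_int c * \<theta>\<bar> \<le> \<delta>}" for c :: int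
  have "I c = {a. of_int c * \<theta> - \<delta> \<le> of_int a \<and> of_int a \<le> of_int c * \<theta> + \<delta>}" for c
    by (auto simp: I_def)
  moreover have "c * \<theta> - \<delta> \<le> c * \<theta> + \<delta>" for c :: real using \<delta> by simp
  note interval = card_Int_real_interval_le[OF this]
  ultimately have I: "finite (I c)" "real (card (I c)) \<le> 2 * \<delta> + 1" for c
    using interval[of "of_int c"] by simp_all
  show "finite S" using I(1) by (simp add: S_def I_def)
  have "real (card S) = (\<Sum>c\<in>{- int N..int N}. real (card (I c)))"
    using I(1) by (simp add: S_def I_def)
  also have "\<dots> \<le> real (card {- int N..int N}) * (2 * \<delta> + 1)" by (rule sum_bounded_above[OF I(2)])
  finally show "real (card S) \<le> (2 * real N + 1) * (2 * \<delta> + 1)" by simp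
qed

lemma abs_upper_left_diff_le:
  assumes g: "g \<in> sl2_box N" "g$2$1 \<noteq> 0" and near: "\<bar>image_of_infinity g - \<theta>\<bar> < \<rho>"
  shows "\<bar>of_int (g$1$1) - of_int (g$2$1) * \<theta>\<bar> \<le> \<rho> * real N"
proof -
  define a c where ac: "a = real_of_int (g$1$1)" "c = real_of_int (g$2$1)"
  have c: "c \<noteq> 0" "\<bar>c\<bar> \<le> real N"
    using g sl2_box_nth[of g N 2 1] by (auto simp: ac abs_le_iff)
  have "\<bar>a - c * \<theta>\<bar> = \<bar>a / c - \<theta>\<bar> * \<bar>c\<bar>"
    using c(1) by (simp add: algebra_simps flip: abs_mult)
  also have "\<dots> \<le> \<rho> * real N"
    using c(2) near by (intro mult_mono) (auto simp: image_of_infinity_def ac)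
  finally show ?thesis by (simp add: ac)
qed

lemma card_image_of_infinity_near_le:
  assumes K: "K > 0" and \<rho>: "\<rho> > 0"
  shows "real (card {g\<in>sl2_box N. int K \<le> \<bar>g$2$1\<bar> \<and> \<bar>image_of_infinity g - \<theta>\<bar> < \<rho>})
    \<le> (2 * real N + 1) * (2 * \<rho> * real N + 1) * (2 * real N / real K + 1)"
proof -
  define A where "A = {g\<in>sl2_box N. int K \<le> \<bar>g$2$1\<bar> \<and> \<bar>image_of_infinity g - \<theta>\<bar> < \<rho>}"
  define B where "B = (SIGMA c:{- int N..int N}. {a::int. \<bar>of_int a - of_int c * \<theta>\<bar> \<le> \<rho> * real N})"
  have B: "finite B" "real (card B) \<le> (2 * real N + 1) * (2 * \<rho> * real N + 1)"
    unfolding B_def using card_near_line_le[of "\<rho> * real N" N \<theta>] \<rho> by (simp_all add: mult.assoc)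
  have "real (card A) \<le> real (card B) * (2 * real N / real K + 1)"
  proof (rule card_le_card_times_fibre[OF _ B(1)])
    show "(\<lambda>g. (g$2$1, g$1$1)) ` A \<subseteq> B"
    proof (rule image_subsetI)
      fix g
      assume g: "g \<in> A"
      then have "\<bar>of_int (g$1$1) - of_int (g$2$1) * \<theta>\<bar> \<le> \<rho> * real N"
        using K by (intro abs_upper_left_diff_le) (auto simp: A_def)
      then show "(g$2$1, g$1$1) \<in> B" using g sl2_box_nth[of g N 2 1] by (auto simp: A_def B_def)
    qed
    fix b
    assume "b \<in> B"
    obtain c a where b: "b = (c, a)" by fastforce
    show "real (card {g\<in>A. (g$2$1, g$1$1) = b}) \<le> 2 * real N / real K + 1"
    proof (cases "int K \<le> \<bar>c\<bar>")
      case True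
      then have "c \<noteq> 0" using K by auto
      then have "real (card {g\<in>A. (g$2$1, g$1$1) = b})
          \<le> 2 * real N / \<bar>of_int (vector [a, c] $ (2::2))\<bar> + 1"
        by (intro card_fixed_column_le) (auto simp: A_def b column_def vec_eq_iff forall_2)
      also have "2 * real N / \<bar>of_int (vector [a, c] $ (2::2))\<bar> \<le> 2 * real N / real K"
        using True K by (intro divide_left_mono) auto
      finally show ?thesis by simp
    next
      case False
      then have empty: "{g\<in>A. (g$2$1, g$1$1) = b} = {}" by (auto simp: A_def b)
      show ?thesis unfolding empty by simp
    qed
  qed (simp add: A_def)
  also have "\<dots> \<le> (2 * real N + 1) * (2 * \<rho> * real N + 1) * (2 * real N / real K + 1)"
    using B(2) by (intro mult_right_mono) auto
  finally show ?thesis by (simp add: A_def)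
qed

section \<open>Exceptional matrices and pairs\<close>

text \<open>In the box of size \<open>k\<^sup>6\<close> the thresholds \<open>2 k\<^sup>5\<close> for \<open>\<bar>c\<bar>\<close> and \<open>1 / k\<^sup>2\<close> for the distance of the
  centres make every family of exceptions smaller than \<open>k\<^sup>1\<^sup>2\<close> by a factor of about \<open>k\<close>.\<close>

definition exceptional :: "nat \<Rightarrow> imat \<Rightarrow> bool" where
  "exceptional k g \<longleftrightarrow> \<bar>g$2$1\<bar> < 2 * int k ^ 5 \<or> \<bar>trace g\<bar> \<le> 2"

definition close_to :: "nat \<Rightarrow> real \<Rightarrow> imat \<Rightarrow> bool" where
  "close_to k \<theta> g \<longleftrightarrow> \<bar>image_of_infinity g - \<theta>\<bar> < 1 / (real k)\<^sup>2"

lemma exceptional_sl2_inv [simp]: "exceptional k (sl2_inv g) \<longleftrightarrow> exceptional k g"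
  by (simp add: exceptional_def)

lemma card_small_trace_power_box_le:
  assumes k: "k \<ge> 1"
  shows "card {g\<in>sl2_box (k ^ 6). 2 * int k ^ 5 \<le> \<bar>g$2$1\<bar> \<and> g$1$2 \<noteq> 0 \<and> \<bar>trace g\<bar> \<le> 2}
    \<le> 120 * k ^ 11"
proof -
  define N K where "N = k ^ 6" and "K = 2 * k ^ 5"
  have N: "N \<ge> 1" using k by (simp add: N_def)
  have "k ^ 3 * (N + 1)\<^sup>2 \<le> k ^ 3 * (2 * N)\<^sup>2" using N by (intro mult_left_mono power_mono) auto
  also have "\<dots> = 4 * k ^ 15" by (simp add: N_def power_mult_distrib flip: power_mult power_add)
  also have "\<dots> < K ^ 3" using k by (simp add: K_def power_mult_distrib flip: power_mult)
  finally have "card {g\<in>sl2_box N. int K \<le> \<bar>g$2$1\<bar> \<and> g$1$2 \<noteq> 0 \<and> \<bar>trace g\<bar> \<le> 2}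
      \<le> 20 * (2 * N + 1) * (N div k + 1)"
    using k by (intro card_small_trace_le) auto
  also have "N div k = k ^ 5"
  proof -
    have "N = k * k ^ 5" by (simp add: N_def flip: power_Suc)
    then show ?thesis using k by simp
  qed
  also have "20 * (2 * N + 1) * (k ^ 5 + 1) \<le> 20 * (3 * N) * (2 * k ^ 5)"
    using N k by (intro mult_mono) auto
  also have "\<dots> = 120 * k ^ 11" by (simp add: N_def flip: power_add)
  finally show ?thesis by (simp add: N_def K_def)
qed

lemma card_exceptional_le:
  assumes k: "k \<ge> 1"
  shows "real (card {g\<in>sl2_box (k ^ 6). exceptional k g}) \<le> 200 * real k ^ 11 * harm (k ^ 6)"
proof -
  define N K where "N = k ^ 6" and "K = 2 * k ^ 5"
  define A where "A = {g\<in>sl2_box N. \<bar>g$2$1\<bar> \<le> int K}"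
  define B where "B = {g\<in>sl2_box N. g$1$2 = 0}"
  define C where "C = {g\<in>sl2_box N. 2 * int k ^ 5 \<le> \<bar>g$2$1\<bar> \<and> g$1$2 \<noteq> 0 \<and> \<bar>trace g\<bar> \<le> 2}"
  have N: "N \<ge> 1" using k by (simp add: N_def)
  have h: "1 \<le> (harm N :: real)" by (rule one_le_harm[OF N])
  have k6: "real k ^ 6 \<le> real k ^ 11" using k by (intro power_increasing) auto
  have "real (card A) \<le> 12 * real N * (2 * real K + 1) * harm N"
    unfolding A_def by (rule card_lower_left_le[OF N])
  also have "12 * real N * (2 * real K + 1) = 48 * real k ^ 11 + 12 * real k ^ 6"
    by (simp add: N_def K_def algebra_simps flip: power_add)
  also have "\<dots> * harm N \<le> 60 * real k ^ 11 * harm N" using k6 h by (intro mult_right_mono) auto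
  finally have A: "real (card A) \<le> 60 * real k ^ 11 * harm N" .
  have "real (card B) \<le> 12 * real N * harm N"
    unfolding B_def by (rule card_upper_right_zero_le[OF N])
  also have "\<dots> \<le> 12 * real k ^ 11 * harm N" using k6 h by (intro mult_right_mono) (auto simp: N_def)
  finally have B: "real (card B) \<le> 12 * real k ^ 11 * harm N" .
  have "real (card C) \<le> real (120 * k ^ 11)"
    unfolding C_def N_def by (intro of_nat_mono card_small_trace_power_box_le k)
  also have "\<dots> \<le> 120 * real k ^ 11 * harm N"
    using mult_left_mono[OF h, of "120 * real k ^ 11"] by simp
  finally have C: "real (card C) \<le> 120 * real k ^ 11 * harm N" .
  have "{g\<in>sl2_box N. exceptional k g} \<subseteq> A \<union> B \<union> C"
    by (auto simp: exceptional_def A_def B_def C_def K_def)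
  then have "card {g\<in>sl2_box N. exceptional k g} \<le> card (A \<union> B \<union> C)"
    by (intro card_mono) (auto simp: A_def B_def C_def)
  also have "\<dots> \<le> card A + card B + card C"
    using card_Un_le[of "A \<union> B" C] card_Un_le[of A B] by linarith
  finally have "real (card {g\<in>sl2_box N. exceptional k g}) \<le> 192 * real k ^ 11 * harm N"
    using A B C by linarith
  also have "\<dots> \<le> 200 * real k ^ 11 * harm N" using h by (intro mult_right_mono) auto
  finally show ?thesis by (simp add: N_def)
qed

lemma card_close_to_le:
  assumes k: "k \<ge> 1"
  shows "real (card {g\<in>sl2_box (k ^ 6). \<not> exceptional k g \<and> close_to k \<theta> g}) \<le> 18 * real k ^ 11"
proof -
  define N K where "N = k ^ 6" and "K = 2 * k ^ 5"
  have "{g\<in>sl2_box N. \<not> exceptional k g \<and> close_to k \<theta> g}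
      \<subseteq> {g\<in>sl2_box N. int K \<le> \<bar>g$2$1\<bar> \<and> \<bar>image_of_infinity g - \<theta>\<bar> < 1 / (real k)\<^sup>2}"
    by (auto simp: exceptional_def close_to_def K_def)
  then have "card {g\<in>sl2_box N. \<not> exceptional k g \<and> close_to k \<theta> g}
      \<le> card {g\<in>sl2_box N. int K \<le> \<bar>g$2$1\<bar> \<and> \<bar>image_of_infinity g - \<theta>\<bar> < 1 / (real k)\<^sup>2}"
    by (intro card_mono) auto
  also have "real \<dots>
      \<le> (2 * real N + 1) * (2 * (1 / (real k)\<^sup>2) * real N + 1) * (2 * real N / real K + 1)"
    using k by (intro card_image_of_infinity_near_le) (auto simp: K_def)
  also have "2 * (1 / (real k)\<^sup>2) * real N = 2 * real k ^ 4"
    using k by (simp add: N_def field_simps flip: power_add)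
  also have "2 * real N / real K = real k"
    using k by (simp add: N_def K_def field_simps flip: power_Suc)
  also have "(2 * real N + 1) * (2 * real k ^ 4 + 1) * (real k + 1)
      \<le> (3 * real k ^ 6) * (3 * real k ^ 4) * (2 * real k)"
    using k by (intro mult_mono) (auto simp: N_def)
  also have "\<dots> = 18 * real k ^ 11" by (simp flip: power_add power_Suc2)
  finally show ?thesis by (simp add: N_def)
qed

lemma card_close_to_or_inverse_le:
  assumes k: "k \<ge> 1"
  shows "real (card {g\<in>sl2_box (k ^ 6).
      \<not> exceptional k g \<and> (close_to k \<theta> g \<or> close_to k \<theta> (sl2_inv g))}) \<le> 36 * real k ^ 11"
    (is "real (card ?S) \<le> _")
proof -
  define A where "A = {g\<in>sl2_box (k ^ 6). \<not> exceptional k g \<and> close_to k \<theta> g}"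
  have fin: "finite A" by (simp add: A_def)
  have "?S \<subseteq> A \<union> sl2_inv ` A"
    by (auto simp: A_def intro: rev_image_eqI[of "sl2_inv g" for g])
  then have "card ?S \<le> card (A \<union> sl2_inv ` A)" by (intro card_mono) (simp_all add: fin)
  also have "\<dots> \<le> card A + card A"
    by (intro order.trans[OF card_Un_le] add_left_mono card_image_le fin)
  finally show ?thesis using card_close_to_le[OF k, of \<theta>] unfolding A_def by linarith
qed

lemma schottky_pair_if_not_exceptional:
  fixes k :: nat
  defines "r \<equiv> 1 / (2 * (real k)\<^sup>2)"
  assumes k: "k \<ge> 2" and g: "g \<in> SL2Z" "\<not> exceptional k g" and h: "h \<in> SL2Z" "\<not> exceptional k h"
    and far: "\<And>a b. a \<in> {g, sl2_inv g} \<Longrightarrow> b \<in> {h, sl2_inv h} \<Longrightarrow>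
      \<not> close_to k (image_of_infinity b) a"
  shows "schottky_pair r g h"
proof -
  have "ping_pong_generator r x" if x: "x \<in> SL2Z" "\<not> exceptional k x" for x
  proof -
    have "real_of_int (2 * int k ^ 5) \<le> real_of_int \<bar>x$2$1\<bar>"
      using x(2) unfolding of_int_le_iff by (simp add: exceptional_def)
    moreover have "2 ^ 3 \<le> real k ^ 3" using k by (intro power_mono) auto
    then have "2 * (real k)\<^sup>2 * 2 \<le> 2 * (real k)\<^sup>2 * real k ^ 3"
      using k by (intro mult_left_mono) auto
    ultimately have "4 * (real k)\<^sup>2 \<le> \<bar>real_of_int (x$2$1)\<bar>" by (simp flip: power_add)
    then show ?thesis
      using x k by (simp add: r_def ping_pong_generator_def exceptional_def field_simps)
  qed
  moreover have "ping_pong_domain r g \<inter> ping_pong_domain r h = {}"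
    using far by (intro disjoint_ping_pong_domains) (simp add: r_def close_to_def not_less)
  ultimately show ?thesis using g h by (simp add: schottky_pair_def)
qed

lemma card_not_thin_partners_le:
  assumes k: "k \<ge> 2" and h: "h \<in> SL2Z" "\<not> exceptional k h"
  shows "real (card {g\<in>sl2_box (k ^ 6). \<not> thin (Gamma (g, h))}) \<le> 272 * real k ^ 11 * harm (k ^ 6)"
proof -
  define T where "T = {g\<in>sl2_box (k ^ 6). \<not> thin (Gamma (g, h))}"
  define E where "E = {g\<in>sl2_box (k ^ 6). exceptional k g}"
  define near where "near b = {g\<in>sl2_box (k ^ 6). \<not> exceptional k g \<and>
    (close_to k (image_of_infinity b) g \<or> close_to k (image_of_infinity b) (sl2_inv g))}" for b
  have "T \<subseteq> E \<union> (near h \<union> near (sl2_inv h))"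
  proof
    fix g
    assume g: "g \<in> T"
    show "g \<in> E \<union> (near h \<union> near (sl2_inv h))"
    proof (cases "exceptional k g")
      case False
      have "\<not> schottky_pair (1 / (2 * (real k)\<^sup>2)) g h"
        using g schottky_pair_thin by (auto simp: T_def)
      then obtain a b where "a \<in> {g, sl2_inv g}" "b \<in> {h, sl2_inv h}"
        "close_to k (image_of_infinity b) a"
        using schottky_pair_if_not_exceptional[OF k _ False h] g by (auto simp: T_def sl2_box_def)
      then show ?thesis using g False by (auto simp: T_def near_def)
    qed (use g in \<open>simp add: T_def E_def\<close>)
  qed
  then have "card T \<le> card (E \<union> (near h \<union> near (sl2_inv h)))"
    by (intro card_mono) (auto simp: E_def near_def)
  also have "\<dots> \<le> card E + (card (near h) + card (near (sl2_inv h)))"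
    by (intro order.trans[OF card_Un_le] add_left_mono card_Un_le)
  finally have "card T \<le> card E + (card (near h) + card (near (sl2_inv h)))" .
  moreover have "real (card (near b)) \<le> 36 * real k ^ 11" for b
    unfolding near_def using k by (intro card_close_to_or_inverse_le) simp
  note this[of h] this[of "sl2_inv h"]
  moreover have "real (card E) \<le> 200 * real k ^ 11 * harm (k ^ 6)"
    unfolding E_def using k by (intro card_exceptional_le) simp
  moreover have "72 * real k ^ 11 * 1 \<le> 72 * real k ^ 11 * harm (k ^ 6)"
    using k by (intro mult_left_mono one_le_harm) auto
  ultimately show ?thesis unfolding T_def by linarith
qed

lemma card_pairs_eq_sum:
  assumes "finite B"
  shows "card {p \<in> B \<times> B. P p} = (\<Sum>y\<in>B. card {x\<in>B. P (x, y)})"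
proof -
  have "card {p \<in> B \<times> B. P p} = card (prod.swap ` {p \<in> B \<times> B. P p})"
    by (simp add: card_image)
  also have "prod.swap ` {p \<in> B \<times> B. P p} = (SIGMA y:B. {x\<in>B. P (x, y)})" by force
  also have "card \<dots> = (\<Sum>y\<in>B. card {x\<in>B. P (x, y)})" using assms by simp
  finally show ?thesis .
qed

lemma card_not_thin_pairs_le:
  assumes k: "k \<ge> 2" and B: "B \<subseteq> sl2_box (k ^ 6)"
  shows "real (card {g \<in> B \<times> B. \<not> thin (Gamma g)})
    \<le> 500 * real k ^ 11 * harm (k ^ 6) * real (card B)"
proof -
  define E where "E = {g\<in>B. exceptional k g}"
  define T where "T h = {g\<in>B. \<not> thin (Gamma (g, h))}" for h
  define X where "X = real k ^ 11 * harm (k ^ 6)"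
  have fin: "finite B" by (rule finite_subset[OF B]) simp
  have X: "0 \<le> X" by (simp add: X_def harm_nonneg)
  have "card E \<le> card {g\<in>sl2_box (k ^ 6). exceptional k g}"
    unfolding E_def using B by (intro card_mono) auto
  then have E: "real (card E) \<le> 200 * X" using card_exceptional_le[of k] k by (simp add: X_def)
  have partners: "real (card (T h)) \<le> 272 * X + (if h \<in> E then real (card B) else 0)"
    if h: "h \<in> B" for h
  proof (cases "h \<in> E")
    case True
    have "card (T h) \<le> card B" unfolding T_def using fin by (intro card_mono) auto
    then show ?thesis using True X by simp
  next
    case False
    then have "h \<in> SL2Z" "\<not> exceptional k h" using h B by (auto simp: E_def sl2_box_def)
    note card_not_thin_partners_le[OF k this]
    moreover have "card (T h) \<le> card {g\<in>sl2_box (k ^ 6). \<not> thin (Gamma (g, h))}"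
      unfolding T_def using B by (intro card_mono) auto
    ultimately show ?thesis using False by (simp add: X_def)
  qed
  have "real (card {g \<in> B \<times> B. \<not> thin (Gamma g)}) = (\<Sum>h\<in>B. real (card (T h)))"
    by (simp add: T_def card_pairs_eq_sum[OF fin])
  also have "\<dots> \<le> (\<Sum>h\<in>B. 272 * X + (if h \<in> E then real (card B) else 0))"
    by (rule sum_mono[OF partners])
  also have "\<dots> = 272 * X * real (card B) + real (card E) * real (card B)"
    by (simp add: sum.distrib sum.If_cases[OF fin] E_def Int_def)
  also have "\<dots> \<le> 272 * X * real (card B) + 200 * X * real (card B)"
    by (intro add_left_mono mult_right_mono E) simp
  also have "\<dots> \<le> 500 * X * real (card B)" using X by (simp add: mult_right_mono)
  finally show ?thesis by (simp add: X_def mult.assoc)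
qed

section \<open>Completing coprime columns\<close>

lemma sum_inverse_squares_le: "(\<Sum>k=2..n. 1 / (real k)\<^sup>2) \<le> 3 / 4"
proof (cases "n \<ge> 2")
  case True
  then have "(\<Sum>k=2..n. 1 / (real k)\<^sup>2) \<le> 3 / 4 - 1 / real n"
  proof (induction n rule: dec_induct)
    case (step n)
    have "1 / (real (Suc n))\<^sup>2 \<le> 1 / (real n * real (Suc n))"
      using step by (intro divide_left_mono) (auto simp: power2_eq_square)
    also have "\<dots> = 1 / real n - 1 / real (Suc n)" using step by (simp add: field_simps)
    finally show ?case using step by simp
  qed simp
  then show ?thesis by (rule order.trans) simp
qed simp

lemma card_multiples:
  fixes k n :: nat
  assumes k: "k > 0"
  shows "card {a\<in>{1..n}. k dvd a} = n div k"
proof -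
  have "{a\<in>{1..n}. k dvd a} = (\<lambda>i. k * i) ` {1..n div k}"
  proof (intro equalityI subsetI)
    fix a
    assume "a \<in> {a\<in>{1..n}. k dvd a}"
    then obtain i where i: "a = k * i" "1 \<le> k * i" "k * i \<le> n" by auto
    then have "1 \<le> i" "i \<le> n div k"
      using k by (auto simp: less_eq_div_iff_mult_less_eq mult.commute Suc_le_eq)
    then show "a \<in> (\<lambda>i. k * i) ` {1..n div k}" using i by simp
  qed (use k in \<open>auto simp: less_eq_div_iff_mult_less_eq mult.commute Suc_le_eq\<close>)
  then show ?thesis using k by (simp add: card_image inj_on_def)
qed

lemma card_coprime_pairs_ge:
  "(real n)\<^sup>2 / 4 \<le> real (card {(a, c). a \<in> {1..n} \<and> c \<in> {1..n} \<and> coprime a c})"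
proof -
  define C where "C = {(a, c). a \<in> {1..n} \<and> c \<in> {1..n} \<and> coprime a c}"
  define D where "D k = {a\<in>{1..n}. k dvd a}" for k
  have "{1..n} \<times> {1..n} - C \<subseteq> (\<Union>k\<in>{2..n}. D k \<times> D k)"
  proof
    fix p
    assume "p \<in> {1..n} \<times> {1..n} - C"
    then obtain a c where p: "p = (a, c)" and ac: "a \<in> {1..n}" "c \<in> {1..n}" "\<not> coprime a c"
      by (cases p) (auto simp: C_def)
    have "gcd a c \<noteq> 1" "gcd a c \<noteq> 0" "gcd a c \<le> a"
      using ac gcd_le1_nat[of a c] by (auto simp: coprime_iff_gcd_eq_1)
    then have "gcd a c \<in> {2..n}" using ac(1) unfolding atLeastAtMost_iff by linarith
    then show "p \<in> (\<Union>k\<in>{2..n}. D k \<times> D k)" using ac p by (auto simp: D_def)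
  qed
  then have "card ({1..n} \<times> {1..n} - C) \<le> card (\<Union>k\<in>{2..n}. D k \<times> D k)"
    by (intro card_mono) (auto simp: D_def)
  also have "\<dots> \<le> (\<Sum>k=2..n. card (D k \<times> D k))" by (rule card_UN_le) simp
  also have "real \<dots> \<le> (\<Sum>k=2..n. (real n)\<^sup>2 * (1 / (real k)\<^sup>2))"
    unfolding of_nat_sum
  proof (rule sum_mono)
    fix k
    assume "k \<in> {2..n}"
    then have "card (D k) = n div k" unfolding D_def by (intro card_multiples) simp
    then have "real (card (D k)) \<le> real n / real k" by (simp add: of_nat_div_le_of_nat)
    then have "(real (card (D k)))\<^sup>2 \<le> (real n / real k)\<^sup>2" by (intro power_mono) auto
    then show "real (card (D k \<times> D k)) \<le> (real n)\<^sup>2 * (1 / (real k)\<^sup>2)"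
      by (simp add: card_cartesian_product power2_eq_square)
  qed
  also have "\<dots> \<le> (real n)\<^sup>2 * (3 / 4)"
    unfolding sum_distrib_left[symmetric] by (intro mult_left_mono sum_inverse_squares_le) simp
  finally have "real (card ({1..n} \<times> {1..n} - C)) \<le> (real n)\<^sup>2 * (3 / 4)" by simp
  moreover have "C \<subseteq> {1..n} \<times> {1..n}" by (auto simp: C_def)
  then have "card ({1..n} \<times> {1..n}) = card ({1..n} \<times> {1..n} - C) + card C"
    using card_Int_Diff[of "{1..n} \<times> {1..n}" C] by (simp only: Int_absorb1) simp
  then have "(real n)\<^sup>2 = real (card ({1..n} \<times> {1..n} - C)) + real (card C)"
    by (simp add: card_cartesian_product power2_eq_square flip: of_nat_mult of_nat_add)
  ultimately show ?thesis by (simp add: C_def)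
qed

lemma coprime_column_completion:
  assumes ac: "a \<in> {1..n}" "c \<in> {1..n}" "coprime a c"
  obtains g where "g \<in> sl2_box n" "g$1$1 = int a" "g$2$1 = int c"
proof -
  have "coprime (int a) (int c)" using ac by simp
  then obtain u v where uv: "u * int a + v * int c = 1" using bezout_int[of "int a" "int c"] by auto
  define d q where "d = u mod int c" and "q = u div int c"
  define b where "b = - v - int a * q"
  have c: "int c > 0" using ac by simp
  have d: "0 \<le> d" "d < int c" using c by (simp_all add: d_def)
  have "u = d + int c * q" by (simp add: d_def q_def)
  then have b: "int a * d - 1 = int c * b" using uv unfolding b_def by algebra
  have "0 \<le> int a * d" "int a * d \<le> int a * int c" using d by (auto intro: mult_left_mono)
  then have "int c * (- 1) \<le> int c * b" "int c * b \<le> int c * int a"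
    using b c by (simp_all only: mult.commute[of "int c"])
  then have "- 1 \<le> b" "b \<le> int a" using c by (simp_all only: mult_le_cancel_left_pos)
  then have "mat22 (int a) b (int c) d \<in> sl2_box n"
    using ac d b by (auto simp: sl2_box_def SL2Z_iff forall_2 algebra_simps)
  then show ?thesis using that by simp
qed

lemma card_sl2_box_ge: "(real n)\<^sup>2 / 4 \<le> real (card (sl2_box n))"
proof -
  define C where "C = {(a, c). a \<in> {1..n} \<and> c \<in> {1..n} \<and> coprime a c}"
  have "C \<subseteq> (\<lambda>g. (nat (g$1$1), nat (g$2$1))) ` sl2_box n"
  proof
    fix p
    assume "p \<in> C"
    then obtain a c where p: "p = (a, c)" and ac: "a \<in> {1..n}" "c \<in> {1..n}" "coprime a c"
      by (auto simp: C_def)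
    then show "p \<in> (\<lambda>g. (nat (g$1$1), nat (g$2$1))) ` sl2_box n"
      using coprime_column_completion[OF ac] by (metis (no_types, lifting) image_eqI nat_int)
  qed
  then have "card C \<le> card (sl2_box n)" by (rule surj_card_le[OF finite_sl2_box])
  then show ?thesis using card_coprime_pairs_ge[of n] unfolding C_def by linarith
qed

section \<open>Norm balls\<close>

lemma norm_matrix_vector_mult_le: "norm (A *v x) \<le> norm A * norm x" for A :: "real^'n^'m"
proof -
  have "(norm (A *v x))\<^sup>2 = (\<Sum>i\<in>UNIV. (A$i \<bullet> x)\<^sup>2)"
    by (simp add: norm_vec_def L2_set_def sum_nonneg matrix_vector_mul_component)
  also have "\<dots> \<le> (\<Sum>i\<in>UNIV. (norm (A$i))\<^sup>2 * (norm x)\<^sup>2)"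
    by (intro sum_mono) (metis Cauchy_Schwarz_ineq power2_norm_eq_inner)
  also have "\<dots> = (norm A * norm x)\<^sup>2"
    by (simp add: norm_vec_def L2_set_def sum_nonneg power_mult_distrib flip: sum_distrib_right)
  finally show ?thesis by (rule power2_le_imp_le) simp
qed

lemma trace_transpose_mult: "trace (transpose A ** A) = (norm A)\<^sup>2" for A :: "real^'n^'m"
proof -
  have "trace (transpose A ** A) = (\<Sum>j\<in>UNIV. \<Sum>i\<in>UNIV. (A$i$j)\<^sup>2)"
    by (simp add: trace_def matrix_matrix_mult_def transpose_def power2_eq_square)
  also have "\<dots> = (\<Sum>i\<in>UNIV. \<Sum>j\<in>UNIV. (A$i$j)\<^sup>2)" by (rule sum.swap)
  also have "\<dots> = (norm A)\<^sup>2" by (simp add: norm_vec_def L2_set_def sum_nonneg)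
  finally show ?thesis .
qed

lemma eigenvalue_transpose_mult_le:
  fixes A :: "real^'n^'m"
  assumes "(transpose A ** A) *v v = l *\<^sub>R v" "v \<noteq> 0"
  shows "l \<le> (norm A)\<^sup>2"
proof -
  have "l * (norm v)\<^sup>2 = ((transpose A ** A) *v v) \<bullet> v"
    by (simp add: assms(1) power2_norm_eq_inner)
  also have "\<dots> = (norm (A *v v))\<^sup>2"
    by (simp add: power2_norm_eq_inner transpose_matrix_vector dot_lmul_matrix
        flip: matrix_vector_mul_assoc)
  also have "\<dots> \<le> (norm A * norm v)\<^sup>2" by (intro power_mono norm_matrix_vector_mult_le) simp
  finally show ?thesis using assms(2) by (simp add: power_mult_distrib)
qed

lemma symmetric_mat2_large_eigenvalue:
  fixes M :: "real^2^2"
  assumes M: "transpose M = M"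
  obtains l v where "v \<noteq> 0" "M *v v = l *\<^sub>R v" "trace M \<le> 2 * l"
proof -
  define p q s where pqs: "p = M$1$1" "q = M$1$2" "s = M$2$2"
  have "M$2$1 = q" using arg_cong[OF M, of "\<lambda>M. M$1$2"] by (simp add: transpose_def pqs)
  define l where "l = (p + s + sqrt ((p - s)\<^sup>2 + 4 * q\<^sup>2)) / 2"
  have "2 * l - (p + s) = sqrt ((p - s)\<^sup>2 + 4 * q\<^sup>2)" by (simp add: l_def field_simps)
  then have "(2 * l - (p + s))\<^sup>2 = (p - s)\<^sup>2 + 4 * q\<^sup>2" by simp
  then have l: "(l - p) * (l - s) = q * q" by (simp add: power2_eq_square algebra_simps)
  have tr: "trace M \<le> 2 * l" by (simp add: l_def trace_2 pqs)
  have "det (mat l - M) = 0" using l \<open>M$2$1 = q\<close> by (simp add: det_2 pqs)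
  then have "\<not> invertible (mat l - M)" by (simp add: invertible_det_nz)
  then obtain v where v: "(mat l - M) *v v = 0" "v \<noteq> 0"
    unfolding invertible_left_inverse matrix_left_invertible_ker by blast
  have "M *v v = l *\<^sub>R v"
    using v(1) by (simp add: vec_eq_iff forall_2 matrix_vector_mult_nth_2 left_diff_distrib)
  then show ?thesis using that v(2) tr by blast
qed

lemma lambda_max_bounds:
  fixes A :: "real^2^2"
  defines "L \<equiv> lambda_max (transpose A ** A)"
  shows "L \<le> (norm A)\<^sup>2" and "(norm A)\<^sup>2 \<le> 2 * L"
proof -
  define E where "E = {l. \<exists>v::real^2. v \<noteq> 0 \<and> (transpose A ** A) *v v = l *\<^sub>R v}"
  have upper: "l \<le> (norm A)\<^sup>2" if "l \<in> E" for l
    using that eigenvalue_transpose_mult_le[of A] by (auto simp: E_def)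
  have "transpose (transpose A ** A) = transpose A ** A"
    by (simp add: matrix_transpose_mul)
  then obtain l where l: "l \<in> E" "(norm A)\<^sup>2 \<le> 2 * l"
    using symmetric_mat2_large_eigenvalue[of "transpose A ** A"]
    unfolding E_def trace_transpose_mult by blast
  have L: "L = Sup E" by (simp add: L_def lambda_max_def E_def)
  show "L \<le> (norm A)\<^sup>2" unfolding L using l(1) upper by (intro cSup_least) auto
  have "l \<le> Sup E" using l(1) upper by (intro cSup_upper bdd_aboveI) auto
  then show "(norm A)\<^sup>2 \<le> 2 * L" using l(2) L by simp
qed

lemma ball_subset_sl2_box:
  assumes "2 * X \<le> real n"
  shows "ball_X X \<subseteq> sl2_box n"
proof
  fix g
  assume g: "g \<in> ball_X X"
  define L where "L = lambda_max (transpose (to_real g) ** to_real g)"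
  have L: "(norm (to_real g))\<^sup>2 \<le> 2 * L" unfolding L_def by (rule lambda_max_bounds)
  then have "0 \<le> L" using zero_le_power2[of "norm (to_real g)"] by linarith
  have "(norm (to_real g))\<^sup>2 \<le> (2 * sqrt L)\<^sup>2" using L \<open>0 \<le> L\<close> by (simp add: power_mult_distrib)
  then have "norm (to_real g) \<le> 2 * sqrt L" by (rule power2_le_imp_le) (simp add: \<open>0 \<le> L\<close>)
  also have "\<dots> \<le> real n" using g assms by (simp add: ball_X_def mnorm_def L_def)
  finally have norm: "norm (to_real g) \<le> real n" .
  have "\<bar>real_of_int (g$i$j)\<bar> \<le> real n" for i j
  proof -
    have "\<bar>real_of_int (g$i$j)\<bar> = \<bar>to_real g $ i $ j\<bar>" by (simp add: to_real_def)
    also have "\<dots> \<le> norm (to_real g $ i)" by (rule component_le_norm_cart)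
    also have "\<dots> \<le> norm (to_real g)" by (rule Finite_Cartesian_Product.norm_nth_le)
    finally show ?thesis using norm by linarith
  qed
  then have "\<bar>g$i$j\<bar> \<le> int n" for i j by (metis of_int_abs of_int_le_iff of_int_of_nat_eq)
  then show "g \<in> sl2_box n" using g by (simp add: sl2_box_def ball_X_def)
qed

lemma sl2_box_subset_ball:
  assumes "4 * real n \<le> X"
  shows "sl2_box n \<subseteq> ball_X X"
proof
  fix g
  assume g: "g \<in> sl2_box n"
  have entry: "\<bar>to_real g $ i $ j\<bar> \<le> real n" for i j
  proof -
    have "real_of_int \<bar>g$i$j\<bar> \<le> real_of_int (int n)"
      using g unfolding of_int_le_iff by (simp add: sl2_box_def)
    then show ?thesis by (simp add: to_real_def)
  qed
  have "norm (to_real g $ i) \<le> 2 * real n" for i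
    using norm_le_l1_cart[of "to_real g $ i"] entry[of i 1] entry[of i 2] by (simp add: sum_2)
  moreover have "norm (to_real g) \<le> (\<Sum>i\<in>UNIV. norm (to_real g $ i))"
    unfolding norm_vec_def by (rule L2_set_le_sum) simp
  ultimately have "norm (to_real g) \<le> X" using assms by (simp add: sum_2) (smt (verit))
  then have "lambda_max (transpose (to_real g) ** to_real g) \<le> X\<^sup>2"
    using lambda_max_bounds(1)[of "to_real g"] power_mono[of "norm (to_real g)" X 2] by simp
  moreover have "0 \<le> X" using assms by linarith
  ultimately show "g \<in> ball_X X"
    using g by (simp add: ball_X_def sl2_box_def mnorm_def real_le_lsqrt)
qed

lemma finite_ball_X [simp]: "finite (ball_X X)"
proof (rule finite_subset[OF ball_subset_sl2_box])
  show "2 * X \<le> real (nat \<lceil>2 * X\<rceil>)" by linarith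
qed simp

lemma card_ball_ge:
  assumes "X \<ge> 8"
  shows "X\<^sup>2 / 256 \<le> real (card (ball_X X))"
proof -
  define n where "n = nat \<lfloor>X / 4\<rfloor>"
  have n: "X / 8 \<le> real n" "4 * real n \<le> X" using assms unfolding n_def by linarith+
  have "X\<^sup>2 / 256 = (X / 8)\<^sup>2 / 4" by (simp add: power_divide)
  also have "\<dots> \<le> (real n)\<^sup>2 / 4" using n(1) assms by (intro divide_right_mono power_mono) auto
  also have "\<dots> \<le> real (card (sl2_box n))" by (rule card_sl2_box_ge)
  also have "\<dots> \<le> real (card (ball_X X))"
    by (intro of_nat_mono card_mono sl2_box_subset_ball n(2) finite_ball_X)
  finally show ?thesis .
qed

section \<open>Generic pairs generate thin groups\<close>

lemma harm_le_ln:
  assumes "n \<ge> 1"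
  shows "harm n \<le> 1 + ln (real n)"
proof -
  obtain m where m: "n = Suc m" using assms by (cases n) auto
  have "harm (Suc m) - ln (Suc m) \<le> harm (Suc 0) - ln (Suc 0)"
    using decseqD[OF decseq_harm_diff_ln, of 0 m] by simp
  then show ?thesis by (simp add: m harm_def)
qed

lemma mu_thin_le_1: "mu_thin X \<le> 1"
proof -
  have "mu_thin X \<le> real (card (ball_X X \<times> ball_X X)) / real (card (ball_X X \<times> ball_X X))"
    unfolding mu_thin_def by (intro divide_right_mono of_nat_mono card_mono) auto
  also have "\<dots> \<le> 1" by (simp add: divide_self_if)
  finally show ?thesis .
qed

lemma one_minus_mu_thin_le:
  assumes X: "X \<ge> 8" and k: "2 * X \<le> real k ^ 6"
  shows "1 - mu_thin X \<le> 128000 * real k ^ 11 * harm (k ^ 6) / X\<^sup>2"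
proof -
  define B where "B = ball_X X"
  define T where "T = {g \<in> B \<times> B. thin (Gamma g)}"
  define F where "F = {g \<in> B \<times> B. \<not> thin (Gamma g)}"
  have fin: "finite B" by (simp add: B_def)
  have card_B: "X\<^sup>2 / 256 \<le> real (card B)" unfolding B_def by (rule card_ball_ge[OF X])
  have "0 < X\<^sup>2 / 256" using X by simp
  then have pos: "0 < real (card B)" using card_B by linarith
  have "k \<ge> 2"
  proof (rule ccontr)
    assume "\<not> k \<ge> 2"
    then have "real k ^ 6 \<le> 1 ^ 6" by (intro power_mono) auto
    then show False using k X by simp
  qed
  moreover have "B \<subseteq> sl2_box (k ^ 6)" using k unfolding B_def by (intro ball_subset_sl2_box) simp
  ultimately have F: "real (card F) \<le> 500 * real k ^ 11 * harm (k ^ 6) * real (card B)"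
    unfolding F_def by (rule card_not_thin_pairs_le)
  have "B \<times> B = T \<union> F" "T \<inter> F = {}" by (auto simp: T_def F_def)
  then have "card (B \<times> B) = card T + card F"
    using fin by (metis card_Un_disjoint finite_SigmaI finite_Un)
  then have "real (card T) = real (card B) * real (card B) - real (card F)"
    by (simp add: card_cartesian_product algebra_simps flip: of_nat_mult of_nat_add)
  moreover have "mu_thin X = real (card T) / (real (card B) * real (card B))"
    by (simp add: mu_thin_def T_def B_def card_cartesian_product)
  ultimately have "1 - mu_thin X = real (card F) / (real (card B) * real (card B))"
    using pos by (simp add: diff_divide_distrib)
  also have "\<dots> \<le> 500 * real k ^ 11 * harm (k ^ 6) * real (card B) / (real (card B) * real (card B))"
    by (intro divide_right_mono F) simp
  also have "\<dots> = 500 * real k ^ 11 * harm (k ^ 6) / real (card B)" using pos by simp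
  also have "\<dots> \<le> 500 * real k ^ 11 * harm (k ^ 6) / (X\<^sup>2 / 256)"
    using card_B pos X by (intro divide_left_mono) (auto simp: harm_nonneg)
  finally show ?thesis by simp
qed

lemma mu_thin_ge:
  assumes X: "X \<ge> 8"
  defines "\<kappa> \<equiv> (2 * X) powr (1 / 6) + 1"
  shows "1 - 128000 * \<kappa> ^ 11 * (1 + 6 * ln \<kappa>) / X\<^sup>2 \<le> mu_thin X"
proof -
  define k where "k = nat \<lceil>(2 * X) powr (1 / 6)\<rceil>"
  have k: "(2 * X) powr (1 / 6) \<le> real k" "real k \<le> \<kappa>" by (simp_all add: k_def \<kappa>_def)
  have "0 < (2 * X) powr (1 / 6)" using X by simp
  then have "k \<ge> 1" using k(1) by linarith
  have "2 * X = ((2 * X) powr (1 / 6)) ^ 6" using X by (simp add: powr_power)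
  also have "\<dots> \<le> real k ^ 6" using k(1) by (intro power_mono) auto
  finally have "1 - mu_thin X \<le> 128000 * real k ^ 11 * harm (k ^ 6) / X\<^sup>2"
    by (rule one_minus_mu_thin_le[OF X])
  also have "harm (k ^ 6) \<le> 1 + 6 * ln (real k)"
    using harm_le_ln[of "k ^ 6"] \<open>k \<ge> 1\<close> by (simp add: ln_realpow)
  also have "128000 * real k ^ 11 * (1 + 6 * ln (real k)) / X\<^sup>2
      \<le> 128000 * \<kappa> ^ 11 * (1 + 6 * ln \<kappa>) / X\<^sup>2"
    using k(2) \<open>k \<ge> 1\<close> by (intro divide_right_mono mult_mono power_mono add_mono) auto
  finally show ?thesis by (simp add: divide_right_mono mult_left_mono)
qed

theorem theorem2p1:
  shows "(mu_thin \<longlongrightarrow> 1) at_top"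
proof (rule tendsto_sandwich)
  let ?\<kappa> = "\<lambda>X::real. (2 * X) powr (1 / 6) + 1"
  show "((\<lambda>X. 1 - 128000 * ?\<kappa> X ^ 11 * (1 + 6 * ln (?\<kappa> X)) / X\<^sup>2) \<longlongrightarrow> 1) at_top"
    by real_asymp
  show "\<forall>\<^sub>F X in at_top. 1 - 128000 * ?\<kappa> X ^ 11 * (1 + 6 * ln (?\<kappa> X)) / X\<^sup>2 \<le> mu_thin X"
    using eventually_ge_at_top[of 8] by eventually_elim (rule mu_thin_ge)
  show "\<forall>\<^sub>F X in at_top. mu_thin X \<le> 1" by (simp add: mu_thin_le_1)
qed simp

end
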